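(* Let $S\subset A^*$ be a uniformly recurrent tree set and let $X,Z\subset S$ be finite bifix codes such that $X$ decomposes as $X=Y\circ_f Z$, where $f:B^*\to A^*$ is a coding morphism for $Z$. Set $T=f^{-1}(S)$. Then $X$ is an $S$-maximal bifix code if and only if $Y$ is a $T$-maximal bifix code and $Z$ is an $S$-maximal bifix code. Moreover, in this case, $$d_X(S)=d_Y(T)\,d_Z(S).$$
   Context: Words and sets. $A$ is a finite nonempty alphabet, $A^*$ the free monoid of finite words over $A$, $A^+$ the set of nonempty words. A set $S$ of words is factorial if it contains all factors of its elements. A factorial set $S$ is right-extendable if for every $w\in S$ there is a letter $a$ with $wa\in S$, and biextendable if for every $w\in S$ there are letters $a,b$ with $awb\in S$. A set $S$ is uniformly recurrent if it is (nonempty) factorial and right-extendable and for every $u\in S$ there is $n\ge 1$ such that $u$ is a factor of every word of $S$ of length $n$. Tree sets. For a factorial set $S$ and $w\in S$, let $L(w)=\{a\in A\mid aw\in S\}$, $R(w)=\{a\in A\mid wa\in S\}$, $E(w)=\{(a,b)\in A\times A\mid awb\in S\}$. The extension graph $G(w)$ is the undirected graph whose vertex set is the disjoint union of $L(w)$ and $R(w)$ and whose edges are the pairs $(a,b)\in E(w)$ (joining $a\in L(w)$ to $b\in R(w)$). $S$ is a tree set if it is factorial, biextendable, and for every $w\in S$ (including the empty word) the graph $G(w)$ is a tree, i.e. connected and acyclic. Codes. A prefix code is a set of nonempty words containing no proper prefix of any of its elements; a suffix code is defined symmetrically; a bifix code is both. For a set $S$ of words, a bifix code $X\subset S$ is $S$-maximal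 if it is not properly contained in any bifix code $X'\subset S$. A coding morphism for a code $Z\subset A^+$ is a monoid morphism $f:B^*\to A^*$ mapping the alphabet $B$ bijectively onto $Z$. For finite codes $Y\subset B^*$ and $Z\subset A^*$ such that every letter of $B$ occurs in some word of $Y$, and $f:B^*\to A^*$ a coding morphism for $Z$, the composition is $Y\circ_f Z=f(Y)$. Degree. $X^*$ denotes the submonoid generated by $X$. A parse of a word $w$ with respect to a set $X$ is a triple $(v,x,u)$ with $w=vxu$, where $v$ has no suffix in $X$, $u$ has no prefix in $X$, and $x\in X^*$. The $S$-degree $d_X(S)$ of a bifix code $X$ is the maximum over $w\in S$ of the number of parses of $w$ with respect to $X$. *)

theory Defs
  imports Main "HOL-Library.Sublist" "HOL-Library.Extended_Nat"
begin

text \<open>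
  Words over an alphabet \<open>A :: 'a set\<close> are the elements of \<open>lists A\<close>. The notions below that depend
  on a set \<open>S\<close> of words do not mention \<open>A\<close>: they are used with \<open>S \<subseteq> lists A\<close>, and then every letter
  occurring in a word of \<open>S\<close> is automatically in \<open>A\<close>.
\<close>

section \<open>Sets of words\<close>

definition factorial_set :: "'a list set \<Rightarrow> bool" where
  "factorial_set S \<longleftrightarrow> (\<forall>w\<in>S. \<forall>u. sublist u w \<longrightarrow> u \<in> S)"

definition right_extendable :: "'a list set \<Rightarrow> bool" where
  "right_extendable S \<longleftrightarrow> (\<forall>w\<in>S. \<exists>a. w @ [a] \<in> S)"

definition biextendable :: "'a list set \<Rightarrow> bool" where
  "biextendable S \<longleftrightarrow> (\<forall>w\<in>S. \<exists>a b. a # w @ [b] \<in> S)"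

definition uniformly_recurrent :: "'a list set \<Rightarrow> bool" where
  "uniformly_recurrent S \<longleftrightarrow>
     S \<noteq> {} \<and> factorial_set S \<and> right_extendable S \<and>
     (\<forall>u\<in>S. \<exists>n\<ge>1. \<forall>w\<in>S. length w = n \<longrightarrow> sublist u w)"

section \<open>Extension graphs and tree sets\<close>

text \<open>Simple undirected graphs, given by a vertex set and a set of two-element edges.\<close>

definition graph_connected :: "'v set \<Rightarrow> 'v set set \<Rightarrow> bool" where
  "graph_connected V E \<longleftrightarrow> (\<forall>u\<in>V. \<forall>v\<in>V. (u, v) \<in> {(x, y). {x, y} \<in> E}\<^sup>*)"

definition graph_cycle :: "'v set set \<Rightarrow> 'v list \<Rightarrow> bool" where
  "graph_cycle E c \<longleftrightarrow>
     3 \<le> length c \<and> distinct c \<and>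
     (\<forall>i<length c. {c ! i, c ! (Suc i mod length c)} \<in> E)"

definition graph_tree :: "'v set \<Rightarrow> 'v set set \<Rightarrow> bool" where
  "graph_tree V E \<longleftrightarrow> V \<noteq> {} \<and> graph_connected V E \<and> (\<nexists>c. graph_cycle E c)"

definition left_ext :: "'a list set \<Rightarrow> 'a list \<Rightarrow> 'a set" where
  "left_ext S w = {a. a # w \<in> S}"

definition right_ext :: "'a list set \<Rightarrow> 'a list \<Rightarrow> 'a set" where
  "right_ext S w = {a. w @ [a] \<in> S}"

definition bi_ext :: "'a list set \<Rightarrow> 'a list \<Rightarrow> ('a \<times> 'a) set" where
  "bi_ext S w = {(a, b). a # w @ [b] \<in> S}"

definition ext_verts :: "'a list set \<Rightarrow> 'a list \<Rightarrow> ('a + 'a) set" where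
  "ext_verts S w = left_ext S w <+> right_ext S w"

definition ext_edges :: "'a list set \<Rightarrow> 'a list \<Rightarrow> ('a + 'a) set set" where
  "ext_edges S w = {{Inl a, Inr b} | a b. (a, b) \<in> bi_ext S w}"

definition tree_set :: "'a list set \<Rightarrow> bool" where
  "tree_set S \<longleftrightarrow>
     factorial_set S \<and> biextendable S \<and>
     (\<forall>w\<in>S. graph_tree (ext_verts S w) (ext_edges S w))"

section \<open>Codes\<close>

definition is_code :: "'a list set \<Rightarrow> bool" where
  "is_code X \<longleftrightarrow> (\<forall>us\<in>lists X. \<forall>vs\<in>lists X. concat us = concat vs \<longrightarrow> us = vs)"

definition prefix_code :: "'a list set \<Rightarrow> bool" where
  "prefix_code X \<longleftrightarrow> [] \<notin> X \<and> (\<forall>x\<in>X. \<forall>y\<in>X. \<not> strict_prefix y x)"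

definition suffix_code :: "'a list set \<Rightarrow> bool" where
  "suffix_code X \<longleftrightarrow> [] \<notin> X \<and> (\<forall>x\<in>X. \<forall>y\<in>X. \<not> strict_suffix y x)"

definition bifix_code :: "'a list set \<Rightarrow> bool" where
  "bifix_code X \<longleftrightarrow> prefix_code X \<and> suffix_code X"

definition maximal_bifix_code :: "'a list set \<Rightarrow> 'a list set \<Rightarrow> bool" where
  "maximal_bifix_code S X \<longleftrightarrow>
     bifix_code X \<and> X \<subseteq> S \<and> (\<nexists>X'. bifix_code X' \<and> X' \<subseteq> S \<and> X \<subset> X')"

text \<open>
  A morphism from the free monoid over \<open>B\<close> is a function on \<open>'b list\<close> of which only the values on
  \<open>lists B\<close> matter.
\<close>

definition coding_morphism :: "'b set \<Rightarrow> 'a list set \<Rightarrow> ('b list \<Rightarrow> 'a list) \<Rightarrow> bool" where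
  "coding_morphism B Z f \<longleftrightarrow>
     is_code Z \<and>
     f [] = [] \<and> (\<forall>u\<in>lists B. \<forall>v\<in>lists B. f (u @ v) = f u @ f v) \<and>
     bij_betw (\<lambda>b. f [b]) B Z"

definition decomposes ::
  "'b set \<Rightarrow> ('b list \<Rightarrow> 'a list) \<Rightarrow> 'a list set \<Rightarrow> 'b list set \<Rightarrow> 'a list set \<Rightarrow> bool" where
  "decomposes B f X Y Z \<longleftrightarrow>
     finite Y \<and> is_code Y \<and> Y \<subseteq> lists B \<and> finite Z \<and>
     (\<forall>b\<in>B. \<exists>y\<in>Y. b \<in> set y) \<and>
     coding_morphism B Z f \<and> X = f ` Y"

section \<open>Degree\<close>

definition generated_submonoid :: "'a list set \<Rightarrow> 'a list set" where
  "generated_submonoid X = concat ` lists X"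

definition parses :: "'a list set \<Rightarrow> 'a list \<Rightarrow> ('a list \<times> 'a list \<times> 'a list) set" where
  "parses X w =
     {(v, x, u). w = v @ x @ u \<and> (\<nexists>s. suffix s v \<and> s \<in> X) \<and> (\<nexists>p. prefix p u \<and> p \<in> X) \<and>
        x \<in> generated_submonoid X}"

text \<open>
  Every word has finitely many parses, but the number of parses may be unbounded on \<open>S\<close>, so the
  degree is a supremum in \<open>enat\<close>; it is the maximum whenever it is finite.
\<close>

definition code_degree :: "'a list set \<Rightarrow> 'a list set \<Rightarrow> enat" where
  "code_degree S X = (SUP w\<in>S. enat (card (parses X w)))"

end

theory Submission
  imports Defs
begin

text \<open>
  For a bifix code \<open>Z\<close>, the positions \<open>i \<le> j\<close> of a word with the factor between them in \<open>Z\<^sup>*\<close>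
  form an equivalence relation that is inherited by factors; its classes are the parses of the
  word, and every class has a first and a last position. An \<open>S\<close>-maximal finite bifix code is
  prefix- and suffix-complete in \<open>S\<close>, because a word with the maximal number of parses cannot
  acquire a new class when it is extended.

  The crucial point is that \<open>T\<close> is again uniformly recurrent. Let \<open>K \<subseteq> T\<close> be infinite and
  factorial, and mark the positions of a word of \<open>S\<close> that occur as cuts in encodings of words of
  \<open>K\<close>. The number of marked classes can only decrease under extension, so from some length on
  the marking is unchanged by extension. Since the extension graphs are connected, whether the
  position between \<open>u\<close> and \<open>v\<close> is marked in long extensions of \<open>uv\<close> depends neither on the
  extension nor, by descending induction on the length of \<open>uv\<close>, on \<open>u\<close> and \<open>v\<close>. Hence
  everything is marked and \<open>K = T\<close>.

  With uniform recurrence of \<open>T\<close>, maximality becomes completeness for all three codes, which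
  passes through the composition. For the degree, each \<open>Z\<close>-class of a long word of \<open>S\<close> spells a
  long word of \<open>T\<close> and splits into exactly \<open>d\<^sub>Y(T)\<close> classes of \<open>X\<close>.
\<close>

section \<open>Bifix codes and parses\<close>

text \<open>The alphabet \<open>B\<close> names the codewords through \<open>g\<close>. Besides the
  given \<open>Z\<close>, the locale is instantiated with \<open>B = X\<close> and the identity, so
  whatever is counted here is available for every bifix code.\<close>

locale bifix_coding =
  fixes B :: "'b set" and g :: "'b \<Rightarrow> 'a list" and Z :: "'a list set"
  assumes bifix: "bifix_code Z" and bij: "bij_betw g B Z"
begin

definition enc :: "'b list \<Rightarrow> 'a list" where
  "enc t = concat (map g t)"

lemma enc_simps [simp]:
  "enc [] = []" "enc (b # t) = g b @ enc t" "enc (s @ t) = enc s @ enc t"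
  by (simp_all add: enc_def)

lemma g_in: "b \<in> B \<Longrightarrow> g b \<in> Z"
  using bij by (auto simp: bij_betw_def)

lemma g_obtain: assumes "z \<in> Z" obtains b where "b \<in> B" "g b = z"
  using bij assms by (auto simp: bij_betw_def)

lemma g_inj: "b \<in> B \<Longrightarrow> c \<in> B \<Longrightarrow> g b = g c \<Longrightarrow> b = c"
  using bij by (auto simp: bij_betw_def inj_on_def)

lemma Nil_notin: "[] \<notin> Z"
  using bifix by (auto simp: bifix_code_def prefix_code_def)

lemma g_ne: "b \<in> B \<Longrightarrow> g b \<noteq> []"
  using g_in Nil_notin by metis

lemma prefix_eq: "x \<in> Z \<Longrightarrow> y \<in> Z \<Longrightarrow> prefix x y \<Longrightarrow> x = y"
  using bifix by (auto simp: bifix_code_def prefix_code_def strict_prefix_def)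

lemma suffix_eq: "x \<in> Z \<Longrightarrow> y \<in> Z \<Longrightarrow> suffix x y \<Longrightarrow> x = y"
  using bifix by (auto simp: bifix_code_def suffix_code_def strict_suffix_def)

lemma g_append_eq: "b \<in> B \<Longrightarrow> c \<in> B \<Longrightarrow> g b @ x = g c @ y \<Longrightarrow> b = c \<and> x = y"
  by (metis g_in g_inj prefix_eq prefixI prefix_same_cases same_append_eq)

lemma append_g_eq:
  assumes "b \<in> B" "c \<in> B" "x @ g b = y @ g c"
  shows "b = c \<and> x = y"
proof -
  have "suffix (g b) (g c) \<or> suffix (g c) (g b)"
    using assms(3) by (metis suffixI suffix_same_cases)
  then have "g b = g c"
    using assms g_in suffix_eq by metis
  then show ?thesis
    using assms g_inj by auto
qed

lemma enc_eq_Nil: "t \<in> lists B \<Longrightarrow> enc t = [] \<Longrightarrow> t = []"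
  by (cases t) (auto dest: g_ne)

lemma length_enc: "t \<in> lists B \<Longrightarrow> length t \<le> length (enc t)"
proof (induction t)
  case (Cons b t)
  then have "g b \<noteq> []" using g_ne by auto
  then have "1 \<le> length (g b)" by (cases "g b") auto
  then show ?case using Cons by auto
qed auto

lemma submonoid_eq: "generated_submonoid Z = enc ` lists B"
proof -
  have "g ` B = Z" using bij by (auto simp: bij_betw_def)
  then have "lists Z = map g ` lists B" by (metis lists_image)
  then show ?thesis by (auto simp: generated_submonoid_def enc_def)
qed

text \<open>Both encodings start with codewords that are prefix-comparable and hence equal, so they
  can be peeled off in parallel until one encoding is exhausted.\<close>

lemma enc_prefix:
  assumes "s \<in> lists B" "t \<in> lists B" "enc s @ v = enc t @ v'"
  shows "(\<exists>r\<in>lists B. t = s @ r \<and> v = enc r @ v') \<or> (\<exists>r\<in>lists B. s = t @ r \<and> v' = enc r @ v)"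
  using assms
proof (induction s arbitrary: t rule: list.induct)
  case (Cons b s)
  show ?case
  proof (cases t)
    case Nil
    then show ?thesis using Cons.prems by simp
  next
    case (Cons c t')
    then have "b = c \<and> enc s @ v = enc t' @ v'"
      using Cons.prems by (intro g_append_eq) auto
    then show ?thesis
      using Cons.IH[of t'] Cons.prems Cons by simp
  qed
qed auto

lemma enc_suffix:
  assumes "s \<in> lists B" "t \<in> lists B" "v @ enc s = v' @ enc t"
  shows "(\<exists>r\<in>lists B. t = r @ s \<and> v = v' @ enc r) \<or> (\<exists>r\<in>lists B. s = r @ t \<and> v' = v @ enc r)"
  using assms
proof (induction s arbitrary: t rule: rev_induct)
  case (snoc b s)
  show ?case
  proof (cases t rule: rev_cases)
    case Nil
    then show ?thesis using snoc.prems by simp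
  next
    case (snoc t' c)
    then have "b = c \<and> v @ enc s = v' @ enc t'"
      using snoc.prems by (intro append_g_eq) auto
    then show ?thesis
      using snoc.IH[of t'] snoc.prems snoc by simp
  qed
qed auto

text \<open>The submonoid generated by a prefix code is right unitary: removing from one of its
  elements a prefix that belongs to it leaves an element again.\<close>

lemma enc_right_unitary:
  assumes "s \<in> lists B" "t \<in> lists B" "enc s @ v = enc t"
  obtains r where "r \<in> lists B" "t = s @ r" "v = enc r"
proof -
  from enc_prefix[of s t v "[]"] assms
  consider r where "r \<in> lists B" "t = s @ r" "v = enc r"
    | r where "r \<in> lists B" "s = t @ r" "enc r = []" "v = []"
    by auto
  then show thesis
  proof cases
    case 2
    then show thesis using that[of "[]"] enc_eq_Nil[of r] by simp
  qed (rule that)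
qed

lemma enc_left_unitary:
  assumes "s \<in> lists B" "t \<in> lists B" "v @ enc s = enc t"
  obtains r where "r \<in> lists B" "t = r @ s" "v = enc r"
proof -
  from enc_suffix[of s t v "[]"] assms
  consider r where "r \<in> lists B" "t = r @ s" "v = enc r"
    | r where "r \<in> lists B" "s = r @ t" "enc r = []" "v = []"
    by auto
  then show thesis
  proof cases
    case 2
    then show thesis using that[of "[]"] enc_eq_Nil[of r] by simp
  qed (rule that)
qed

lemma enc_inj: "s \<in> lists B \<Longrightarrow> t \<in> lists B \<Longrightarrow> enc s = enc t \<Longrightarrow> s = t"
  by (metis append_Nil2 enc_eq_Nil enc_right_unitary)

text \<open>No codeword is longer than \<open>w\<close>, so none can reach from before
  \<open>w\<close> to beyond its end: some boundary between codewords of \<open>t\<close> falls in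
  \<open>w\<close> or at one of its ends.\<close>

lemma enc_cut:
  assumes "\<And>z. z \<in> Z \<Longrightarrow> length z \<le> length w"
    and "t \<in> lists B" "enc t = x @ w @ y"
  shows "\<exists>s r u v. t = s @ r \<and> w = u @ v \<and> x @ u = enc s \<and> v @ y = enc r"
  using assms(2,3)
proof (induction t arbitrary: x rule: list.induct)
  case Nil
  then show ?case by (intro exI[of _ "[]"]) auto
next
  case (Cons b t)
  have b: "b \<in> B" "t \<in> lists B" using Cons.prems(1) by simp_all
  have eq: "g b @ enc t = x @ w @ y" using Cons.prems by auto
  show ?case
  proof (cases "length (g b) \<le> length x")
    case True
    then obtain x' where x': "x = g b @ x'" "enc t = x' @ w @ y"
      using eq by (auto simp: append_eq_append_conv2)
    obtain s r u v where "t = s @ r" "w = u @ v" "x' @ u = enc s" "v @ y = enc r"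
      using Cons.IH[OF b(2) x'(2)] by blast
    then show ?thesis
      using x' by (intro exI[of _ "b # s"] exI[of _ r] exI[of _ u] exI[of _ v]) auto
  next
    case False
    then obtain u where u: "g b = x @ u" "u @ enc t = w @ y"
      using eq by (auto simp: append_eq_append_conv2)
    moreover have "length u \<le> length w"
      using assms(1)[OF g_in[OF b(1)]] u by auto
    ultimately obtain v where "w = u @ v" "v @ y = enc t"
      by (auto simp: append_eq_append_conv2)
    then show ?thesis
      using u by (intro exI[of _ "[b]"] exI[of _ t] exI[of _ u] exI[of _ v]) auto
  qed
qed

text \<open>Greedy decoding from the left; it ends because codewords are nonempty, and what remains
  is the last component of a parse.\<close>

lemma ex_enc_prefix: "\<exists>r\<in>lists B. \<exists>v. w = enc r @ v \<and> (\<nexists>p. prefix p v \<and> p \<in> Z)"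
proof (induction w rule: length_induct)
  case (1 w)
  show ?case
  proof (cases "\<exists>p. prefix p w \<and> p \<in> Z")
    case False
    then show ?thesis by (intro bexI[of _ "[]"] exI[of _ w]) auto
  next
    case True
    then obtain p w' where p: "w = p @ w'" "p \<in> Z" by (auto simp: prefix_def)
    with Nil_notin have "length w' < length w" by (cases p) auto
    then obtain r v where r: "r \<in> lists B" "w' = enc r @ v" "\<nexists>p. prefix p v \<and> p \<in> Z"
      using 1 by blast
    obtain b where "b \<in> B" "g b = p" using g_obtain p by metis
    then show ?thesis
      using p r by (intro bexI[of _ "b # r"] exI[of _ v]) auto
  qed
qed

lemma ex_enc_suffix: "\<exists>u. \<exists>r\<in>lists B. w = u @ enc r \<and> (\<nexists>s. suffix s u \<and> s \<in> Z)"
proof (induction w rule: length_induct)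
  case (1 w)
  show ?case
  proof (cases "\<exists>s. suffix s w \<and> s \<in> Z")
    case False
    then show ?thesis by (intro exI[of _ w] bexI[of _ "[]"]) auto
  next
    case True
    then obtain p w' where p: "w = w' @ p" "p \<in> Z" by (auto simp: suffix_def)
    with Nil_notin have "length w' < length w" by (cases p) auto
    then obtain r u where r: "r \<in> lists B" "w' = u @ enc r" "\<nexists>s. suffix s u \<and> s \<in> Z"
      using 1 by blast
    obtain b where "b \<in> B" "g b = p" using g_obtain p by metis
    then show ?thesis
      using p r by (intro exI[of _ u] bexI[of _ "r @ [b]"]) auto
  qed
qed

end

section \<open>Marked cuts and their classes\<close>

definition cut_invariant :: "'a list set \<Rightarrow> ('a list \<Rightarrow> 'a list \<Rightarrow> bool) \<Rightarrow> bool" where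
  "cut_invariant Z M \<longleftrightarrow> (\<forall>u v. \<forall>z\<in>Z. M u (z @ v) = M (u @ z) v)"

text \<open>\<open>M u v\<close> marks the cut between \<open>u\<close> and \<open>v\<close>. Under
  \<open>cut_invariant\<close> the marks are constant on cuts linked by codewords, and a class of
  linked cuts is recorded by its first cut. That cut is stored as a prefix, so it is the same object
  in \<open>w\<close> and in every right extension of \<open>w\<close>.\<close>

definition init_cuts :: "'a list set \<Rightarrow> ('a list \<Rightarrow> 'a list \<Rightarrow> bool) \<Rightarrow> 'a list \<Rightarrow> 'a list set" where
  "init_cuts Z M w = {u. (\<exists>v. w = u @ v \<and> M u v) \<and> (\<nexists>s. suffix s u \<and> s \<in> Z)}"

text \<open>The mirror image: the last cut of a class, stored as a suffix so that extending the word
  to the left does not change it.\<close>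

definition term_cuts :: "'a list set \<Rightarrow> ('a list \<Rightarrow> 'a list \<Rightarrow> bool) \<Rightarrow> 'a list \<Rightarrow> 'a list set" where
  "term_cuts Z M w = {v. (\<exists>u. w = u @ v \<and> M u v) \<and> (\<nexists>p. prefix p v \<and> p \<in> Z)}"

lemma finite_init_cuts: "finite (init_cuts Z M w)"
  by (rule finite_subset[of _ "set (prefixes w)"]) (auto simp: init_cuts_def)

lemma finite_term_cuts: "finite (term_cuts Z M w)"
  by (rule finite_subset[of _ "set (suffixes w)"]) (auto simp: term_cuts_def suffix_def)

context bifix_coding
begin

lemma cut_invariant_enc:
  assumes "cut_invariant Z M" "r \<in> lists B"
  shows "M u (enc r @ v) = M (u @ enc r) v"
  using assms(2)
proof (induction r arbitrary: u)
  case (Cons b r)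
  then have "M u (g b @ enc r @ v) = M (u @ g b) (enc r @ v)"
    using assms(1) g_in by (auto simp: cut_invariant_def)
  then show ?case using Cons by auto
qed auto

text \<open>A remainder without prefix in \<open>Z\<close> cannot contain the next codeword, so of
  two such decodings neither can stop earlier than the other.\<close>

lemma enc_append_eq_enc_append:
  assumes "r \<in> lists B" "r' \<in> lists B" "enc r @ v = enc r' @ v'"
    and "\<nexists>p. prefix p v \<and> p \<in> Z" "\<nexists>p. prefix p v' \<and> p \<in> Z"
  shows "r = r' \<and> v = v'"
proof -
  have no: "q = []"
    if q: "q \<in> lists B" "v1 = enc q @ v2" "\<nexists>p. prefix p v1 \<and> p \<in> Z" for q v1 v2
  proof (cases q)
    case (Cons b q')
    then have "prefix (g b) v1" using q(2) by simp
    moreover have "g b \<in> Z" using q(1) g_in Cons by simp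
    ultimately show ?thesis using q by blast
  qed
  from enc_prefix[OF assms(1-3)] show ?thesis
  proof
    assume "\<exists>q\<in>lists B. r' = r @ q \<and> v = enc q @ v'"
    then obtain q where "q \<in> lists B" "r' = r @ q" "v = enc q @ v'" by blast
    then show ?thesis using no[of q, OF _ _ assms(4)] by auto
  next
    assume "\<exists>q\<in>lists B. r = r' @ q \<and> v' = enc q @ v"
    then obtain q where "q \<in> lists B" "r = r' @ q" "v' = enc q @ v" by blast
    then show ?thesis using no[of q, OF _ _ assms(5)] by auto
  qed
qed

lemma append_enc_eq_append_enc:
  assumes "r \<in> lists B" "r' \<in> lists B" "u @ enc r = u' @ enc r'"
    and "\<nexists>s. suffix s u \<and> s \<in> Z" "\<nexists>s. suffix s u' \<and> s \<in> Z"
  shows "r = r' \<and> u = u'"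
proof -
  have no: "q = []"
    if q: "q \<in> lists B" "u1 = u2 @ enc q" "\<nexists>s. suffix s u1 \<and> s \<in> Z" for q u1 u2
  proof (cases q rule: rev_cases)
    case (snoc q' b)
    then have "u1 = (u2 @ enc q') @ g b" "g b \<in> Z" using q g_in by auto
    then show ?thesis using q(3) by (metis suffixI)
  qed
  from enc_suffix[OF assms(1-3)] show ?thesis
  proof
    assume "\<exists>q\<in>lists B. r' = q @ r \<and> u = u' @ enc q"
    then obtain q where "q \<in> lists B" "r' = q @ r" "u = u' @ enc q" by blast
    then show ?thesis using no[of q, OF _ _ assms(4)] by auto
  next
    assume "\<exists>q\<in>lists B. r = q @ r' \<and> u' = u @ enc q"
    then obtain q where "q \<in> lists B" "r = q @ r'" "u' = u @ enc q" by blast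
    then show ?thesis using no[of q, OF _ _ assms(5)] by auto
  qed
qed

lemma mem_parses_iff:
  "(u, x, v) \<in> parses Z w \<longleftrightarrow> w = u @ x @ v \<and> (\<nexists>s. suffix s u \<and> s \<in> Z) \<and>
     (\<nexists>p. prefix p v \<and> p \<in> Z) \<and> (\<exists>r\<in>lists B. x = enc r)"
  unfolding parses_def submonoid_eq by blast

text \<open>A parse runs through one class of cuts, and its first component is the first cut of the
  class; greedy decoding recovers the rest.\<close>

lemma bij_parses_init:
  "bij_betw fst {(u, x, v) \<in> parses Z w. M u (x @ v)} (init_cuts Z M w)"
    (is "bij_betw _ ?P _")
proof (rule bij_betw_imageI)
  show "inj_on fst ?P"
  proof (rule inj_onI, safe)
    fix u x v u' x' v'
    assume 1: "(u, x, v) \<in> parses Z w" and 2: "(u', x', v') \<in> parses Z w"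
      and 3: "fst (u, x, v) = fst (u', x', v')"
    obtain r r' where r: "r \<in> lists B" "x = enc r" "r' \<in> lists B" "x' = enc r'"
      using 1 2 unfolding mem_parses_iff by blast
    have eq: "enc r @ v = enc r' @ v'"
      using 1 2 3 r unfolding mem_parses_iff by simp
    have "r = r' \<and> v = v'"
      using 1 2 unfolding mem_parses_iff by (intro enc_append_eq_enc_append[OF r(1,3) eq]) simp_all
    then show "u = u'" "x = x'" "v = v'" using 3 r by simp_all
  qed
  show "fst ` ?P = init_cuts Z M w"
  proof (intro equalityI image_subsetI subsetI)
    fix p assume "p \<in> ?P"
    then obtain u x v where p: "p = (u, x, v)" "(u, x, v) \<in> parses Z w" "M u (x @ v)" by blast
    then show "fst p \<in> init_cuts Z M w"
      unfolding mem_parses_iff init_cuts_def by simp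
  next
    fix u assume "u \<in> init_cuts Z M w"
    then obtain v where v: "w = u @ v" "M u v" "\<nexists>s. suffix s u \<and> s \<in> Z"
      unfolding init_cuts_def by blast
    obtain r v' where "r \<in> lists B" "v = enc r @ v'" "\<nexists>p. prefix p v' \<and> p \<in> Z"
      using ex_enc_prefix by blast
    with v have "(u, enc r, v') \<in> parses Z w" "M u (enc r @ v')"
      unfolding mem_parses_iff by auto
    then have "(u, enc r, v') \<in> ?P" by simp
    then show "u \<in> fst ` ?P" by (rule rev_image_eqI) simp
  qed
qed

text \<open>Here a parse is recovered from the last cut of its class; invariance carries the mark
  there from the first cut, where the set of parses tests it.\<close>

lemma bij_parses_term:
  assumes "cut_invariant Z M"
  shows "bij_betw (\<lambda>p. snd (snd p)) {(u, x, v) \<in> parses Z w. M u (x @ v)} (term_cuts Z M w)"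
    (is "bij_betw _ ?P _")
proof (rule bij_betw_imageI)
  show "inj_on (\<lambda>p. snd (snd p)) ?P"
  proof (rule inj_onI, safe)
    fix u x v u' x' v'
    assume 1: "(u, x, v) \<in> parses Z w" and 2: "(u', x', v') \<in> parses Z w"
      and 3: "snd (snd (u, x, v)) = snd (snd (u', x', v'))"
    obtain r r' where r: "r \<in> lists B" "x = enc r" "r' \<in> lists B" "x' = enc r'"
      using 1 2 unfolding mem_parses_iff by blast
    have "u @ x @ v = u' @ x' @ v'"
      using 1 2 unfolding mem_parses_iff by metis
    then have eq: "u @ enc r = u' @ enc r'"
      using 3 r by simp
    have "r = r' \<and> u = u'"
      using 1 2 unfolding mem_parses_iff by (intro append_enc_eq_append_enc[OF r(1,3) eq]) simp_all
    then show "u = u'" "x = x'" "v = v'" using 3 r by simp_all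
  qed
  show "(\<lambda>p. snd (snd p)) ` ?P = term_cuts Z M w"
  proof (intro equalityI image_subsetI subsetI)
    fix p assume "p \<in> ?P"
    then obtain u x v where p: "p = (u, x, v)" "(u, x, v) \<in> parses Z w" "M u (x @ v)" by blast
    then obtain r where r: "r \<in> lists B" "x = enc r"
      unfolding mem_parses_iff by blast
    then have "M (u @ x) v" using p cut_invariant_enc[OF assms] by simp
    moreover have "w = (u @ x) @ v" "\<nexists>p. prefix p v \<and> p \<in> Z"
      using p unfolding mem_parses_iff by simp_all
    ultimately show "snd (snd p) \<in> term_cuts Z M w"
      unfolding term_cuts_def p(1) snd_conv by blast
  next
    fix v assume "v \<in> term_cuts Z M w"
    then obtain u where u: "w = u @ v" "M u v" "\<nexists>p. prefix p v \<and> p \<in> Z"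
      unfolding term_cuts_def by blast
    obtain r u' where r: "r \<in> lists B" "u = u' @ enc r" "\<nexists>s. suffix s u' \<and> s \<in> Z"
      using ex_enc_suffix by blast
    then have "M u' (enc r @ v)"
      using u cut_invariant_enc[OF assms, of r u' v] by simp
    moreover have "(u', enc r, v) \<in> parses Z w"
      unfolding mem_parses_iff using u r by auto
    ultimately have "(u', enc r, v) \<in> parses Z w" "M u' (enc r @ v)"
      by simp_all
    then have "(u', enc r, v) \<in> ?P" by simp
    then show "v \<in> (\<lambda>p. snd (snd p)) ` ?P" by (rule rev_image_eqI) simp
  qed
qed

text \<open>Both sides count the marked parses. This is what lets bounds for right and left
  extension be combined.\<close>

lemma card_init_term:
  assumes "cut_invariant Z M"
  shows "card (init_cuts Z M w) = card (term_cuts Z M w)"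
  using bij_betw_same_card[OF bij_parses_init[of w M]] bij_betw_same_card[OF bij_parses_term[OF assms, of w]]
  by simp

end

section \<open>Connected extension graphs\<close>
definition prefix_complete :: "nat \<Rightarrow> 'a list set \<Rightarrow> 'a list set \<Rightarrow> bool" where
  "prefix_complete L S X \<longleftrightarrow> (\<forall>w\<in>S. L \<le> length w \<longrightarrow> (\<exists>p. prefix p w \<and> p \<in> X))"

definition suffix_complete :: "nat \<Rightarrow> 'a list set \<Rightarrow> 'a list set \<Rightarrow> bool" where
  "suffix_complete L S X \<longleftrightarrow> (\<forall>w\<in>S. L \<le> length w \<longrightarrow> (\<exists>s. suffix s w \<and> s \<in> X))"

definition hereditary :: "('a list \<Rightarrow> 'a list \<Rightarrow> bool) \<Rightarrow> bool" where
  "hereditary M \<longleftrightarrow> (\<forall>x u v y. M (x @ u) (v @ y) \<longrightarrow> M u v)"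

definition stable_from :: "nat \<Rightarrow> 'a list set \<Rightarrow> ('a list \<Rightarrow> 'a list \<Rightarrow> bool) \<Rightarrow> bool" where
  "stable_from N S M \<longleftrightarrow>
     (\<forall>x u v y. N \<le> length (u @ v) \<longrightarrow> x @ u @ v @ y \<in> S \<longrightarrow> M u v \<longrightarrow> M (x @ u) (v @ y))"

definition connected_exts :: "'a list set \<Rightarrow> bool" where
  "connected_exts S \<longleftrightarrow> (\<forall>w\<in>S. graph_connected (ext_verts S w) (ext_edges S w))"

lemma prefix_completeD: "prefix_complete L S X \<Longrightarrow> w \<in> S \<Longrightarrow> L \<le> length w \<Longrightarrow> \<exists>p. prefix p w \<and> p \<in> X"
  unfolding prefix_complete_def by blast

lemma suffix_completeD: "suffix_complete L S X \<Longrightarrow> w \<in> S \<Longrightarrow> L \<le> length w \<Longrightarrow> \<exists>s. suffix s w \<and> s \<in> X"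
  unfolding suffix_complete_def by blast

lemma hereditaryD: "hereditary M \<Longrightarrow> M (x @ u) (v @ y) \<Longrightarrow> M u v"
  unfolding hereditary_def by blast

lemma stable_fromD:
  "stable_from N S M \<Longrightarrow> N \<le> length (u @ v) \<Longrightarrow> x @ u @ v @ y \<in> S \<Longrightarrow> M u v \<Longrightarrow> M (x @ u) (v @ y)"
  unfolding stable_from_def by blast

lemma connected_extsD: "connected_exts S \<Longrightarrow> w \<in> S \<Longrightarrow> graph_connected (ext_verts S w) (ext_edges S w)"
  unfolding connected_exts_def by blast

lemma factorialD: "factorial_set S \<Longrightarrow> x @ w @ y \<in> S \<Longrightarrow> w \<in> S"
  unfolding factorial_set_def by blast

lemma factorial_prefixD: "factorial_set S \<Longrightarrow> w @ y \<in> S \<Longrightarrow> w \<in> S"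
  using factorialD[of S "[]" w y] by simp

lemma factorial_suffixD: "factorial_set S \<Longrightarrow> x @ w \<in> S \<Longrightarrow> w \<in> S"
  using factorialD[of S x w "[]"] by simp

lemma right_extend:
  assumes "right_extendable S" "w \<in> S"
  shows "\<exists>y. w @ y \<in> S \<and> length y = n"
proof (induction n)
  case (Suc n)
  then obtain y where "w @ y \<in> S" "length y = n" by blast
  moreover from this obtain a where "(w @ y) @ [a] \<in> S"
    using assms(1) unfolding right_extendable_def by blast
  ultimately show ?case by (intro exI[of _ "y @ [a]"]) simp
qed (use assms(2) in simp)

lemma connected_constant:
  assumes "graph_connected V E" "p \<in> V" "q \<in> V" "col p"
    and "\<And>x y. {x, y} \<in> E \<Longrightarrow> col x \<Longrightarrow> col y"
  shows "col q"
proof -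
  have "(p, q) \<in> {(x, y). {x, y} \<in> E}\<^sup>*"
    using assms(1-3) unfolding graph_connected_def by blast
  then show ?thesis
    by (induction rule: rtrancl_induct) (use assms(4,5) in blast)+
qed

text \<open>
  A property of marked words \<open>u|v\<close> that does not change when long words are extended is constant:
  going down in length, the extension graph of \<open>uv\<close> links all one-letter extensions of \<open>u|v\<close>,
  and for \<open>u = v = []\<close> nothing is left to depend on.
\<close>

lemma connected_propagate:
  assumes fac: "factorial_set S" and ext: "right_extendable S"
    and conn: "connected_exts S"
    and mono: "hereditary M"
    and stable: "stable_from N S M"
    and start: "u @ v \<in> S" "N \<le> length (u @ v)" "M u v"
    and target: "u' @ v' \<in> S"
  shows "M u' v'"
proof -
  \<comment> \<open>\<open>G\<close> asks for one marked long extension of the cut between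
    \<open>u\<close> and \<open>v\<close>, \<open>H\<close> for all of them to be marked; the aim is
    that \<open>G\<close> implies \<open>H\<close>, by descending induction on the length.\<close>
  define G where "G u v \<longleftrightarrow>
    (\<exists>x y. x @ u @ v @ y \<in> S \<and> N \<le> length (x @ u @ v @ y) \<and> M (x @ u) (v @ y))" for u v
  define H where "H u v \<longleftrightarrow>
    (\<forall>x y. x @ u @ v @ y \<in> S \<longrightarrow> N \<le> length (x @ u @ v @ y) \<longrightarrow> M (x @ u) (v @ y))" for u v
  have GI: "G u v" if "x @ u @ v @ y \<in> S" "N \<le> length (x @ u @ v @ y)" "M (x @ u) (v @ y)" for x u v y
    unfolding G_def using that by blast
  have HD: "M (x @ u) (v @ y)" if "H u v" "x @ u @ v @ y \<in> S" "N \<le> length (x @ u @ v @ y)" for x u v y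
    using that unfolding H_def by blast
  have GH: "H u v" if "u @ v \<in> S" "length (u @ v) = n" "G u v" "n \<le> N" for n u v
    using that(4,1-3)
  proof (induction n arbitrary: u v rule: inc_induct)
    case base
    \<comment> \<open>At length \<open>N\<close> the mark of one extension is inherited by the cut
      itself and then passed on to every extension by stability.\<close>
    then show ?case using hereditaryD[OF mono] stable_fromD[OF stable] unfolding G_def H_def by blast
  next
    case (step n)
    \<comment> \<open>A left letter is coloured by the cut with it prepended, a right letter by the
      cut with it appended. An edge is a word \<open>a # u @ v @ [b]\<close>, and the induction
      hypothesis makes its two ends agree.\<close>
    define col where "col p = (case p of Inl a \<Rightarrow> G (a # u) v | Inr b \<Rightarrow> G u (v @ [b]))" for p
    have edge1: "G u (v @ [b])" if ab: "a # u @ v @ [b] \<in> S" and G: "G (a # u) v" for a b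
    proof -
      have "H (a # u) v"
        using step.IH[of "a # u" v] step.prems factorial_prefixD[OF fac, of "a # u @ v" "[b]"] ab G
        by simp
      \<comment> \<open>The extra \<open>N\<close> letters make the word long enough for
        \<open>H\<close> to apply.\<close>
      moreover obtain y where y: "(a # u @ v @ [b]) @ y \<in> S" "length y = N"
        using right_extend[OF ext ab] by blast
      ultimately have "M ([] @ a # u) (v @ [b] @ y)"
        using HD[of "a # u" v "[]" "[b] @ y"] by simp
      then show ?thesis
        using GI[of "[a]" u "v @ [b]" y] y by simp
    qed
    have edge2: "G (a # u) v" if ab: "a # u @ v @ [b] \<in> S" and G: "G u (v @ [b])" for a b
    proof -
      have "H u (v @ [b])"
        using step.IH[of u "v @ [b]"] step.prems factorial_suffixD[OF fac, of "[a]" "u @ v @ [b]"] ab G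
        by simp
      moreover obtain y where y: "(a # u @ v @ [b]) @ y \<in> S" "length y = N"
        using right_extend[OF ext ab] by blast
      ultimately have "M ([a] @ u) ((v @ [b]) @ y)"
        using HD[of u "v @ [b]" "[a]" y] by simp
      then show ?thesis
        using GI[of "[]" "a # u" v "[b] @ y"] y by simp
    qed
    have edge: "col q" if "{p, q} \<in> ext_edges S (u @ v)" "col p" for p q
    proof -
      obtain a b where "{p, q} = {Inl a, Inr b}" "a # u @ v @ [b] \<in> S"
        using \<open>{p, q} \<in> _\<close> unfolding ext_edges_def bi_ext_def by auto
      then show ?thesis
        using edge1[of a b] edge2[of a b] \<open>col p\<close> unfolding col_def by (auto simp: doubleton_eq_iff)
    qed
    \<comment> \<open>A long extension of a word shorter than \<open>N\<close> adds a letter on some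
      side, and its mark agrees with the colour of that letter.\<close>
    have vertex: "\<exists>p \<in> ext_verts S (u @ v). col p \<longleftrightarrow> M (x @ u) (v @ y)"
      if xy: "x @ u @ v @ y \<in> S" "N \<le> length (x @ u @ v @ y)" for x y
    proof (cases x rule: rev_cases)
      case (snoc x' a)
      then have a: "a # u @ v \<in> S"
        using xy factorialD[OF fac, of x' "a # u @ v" y] by simp
      have "col (Inl a) \<longrightarrow> H (a # u) v"
        using step.IH[of "a # u" v] step.prems a unfolding col_def by simp
      moreover have "M (x @ u) (v @ y) \<longrightarrow> col (Inl a)"
        using xy snoc GI[of x' "a # u" v y] unfolding col_def by simp
      moreover have "H (a # u) v \<longrightarrow> M (x @ u) (v @ y)"
        using xy snoc HD[of "a # u" v x' y] by simp
      moreover have "Inl a \<in> ext_verts S (u @ v)"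
        using a unfolding ext_verts_def left_ext_def by auto
      ultimately show ?thesis by blast
    next
      case Nil
      then obtain b y' where y': "y = b # y'"
        using xy step by (cases y) auto
      then have b: "u @ v @ [b] \<in> S"
        using xy factorialD[OF fac, of x "u @ v @ [b]" y'] by simp
      have "col (Inr b) \<longrightarrow> H u (v @ [b])"
        using step.IH[of u "v @ [b]"] step.prems b unfolding col_def by simp
      moreover have "M (x @ u) (v @ y) \<longrightarrow> col (Inr b)"
        using xy y' GI[of x u "v @ [b]" y'] unfolding col_def by simp
      moreover have "H u (v @ [b]) \<longrightarrow> M (x @ u) (v @ y)"
        using xy y' HD[of u "v @ [b]" x y'] by simp
      moreover have "Inr b \<in> ext_verts S (u @ v)"
        using b unfolding ext_verts_def right_ext_def by auto
      ultimately show ?thesis by blast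
    qed
    obtain x y where xy: "x @ u @ v @ y \<in> S" "N \<le> length (x @ u @ v @ y)" "M (x @ u) (v @ y)"
      using step.prems unfolding G_def by blast
    then obtain p where p: "p \<in> ext_verts S (u @ v)" "col p"
      using vertex[of x y] by blast
    show ?case
      unfolding H_def
    proof (intro allI impI)
      fix x y assume "x @ u @ v @ y \<in> S" "N \<le> length (x @ u @ v @ y)"
      then obtain q where q: "q \<in> ext_verts S (u @ v)" "col q \<longrightarrow> M (x @ u) (v @ y)"
        using vertex[of x y] by blast
      have "col q"
        using connected_constant[where col = col, OF connected_extsD[OF conn step.prems(1)] p(1) q(1) p(2) edge] .
      with q show "M (x @ u) (v @ y)" by blast
    qed
  qed
  have "[] \<in> S" using factorial_prefixD[OF fac, of "[]"] start(1) by simp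
  moreover have "G [] []" using start unfolding G_def by auto
  ultimately have "H [] []" using GH[of "[]" "[]" 0] by simp
  obtain y where "(u' @ v') @ y \<in> S" "length y = N" using right_extend[OF ext target] by blast
  then have "M u' (v' @ y)" using \<open>H [] []\<close> unfolding H_def by simp
  then show ?thesis using hereditaryD[OF mono, of "[]" u' v' y] by simp
qed

section \<open>Marked classes under extension of the word\<close>

lemma init_cuts_append:
  assumes mono: "hereditary M"
    and fac: "factorial_set S" "w @ y \<in> S"
    and suf: "suffix_complete L S Z"
    and w: "L \<le> length w"
  shows "init_cuts Z M (w @ y) \<subseteq> init_cuts Z M w"
proof
  fix u assume "u \<in> init_cuts Z M (w @ y)"
  then obtain v where v: "w @ y = u @ v" "M u v" "\<nexists>s. suffix s u \<and> s \<in> Z"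
    unfolding init_cuts_def by blast
  have "u \<in> S" using factorial_prefixD[OF fac(1), of u v] fac(2) v by simp
  \<comment> \<open>No codeword ends at \<open>u\<close>, so suffix-completeness bounds its length:
    all first cuts lie in the first \<open>L\<close> letters, already inside
    \<open>w\<close>.\<close>
  then have "length u < L" using suffix_completeD[OF suf] v(3) by (meson not_less)
  then have "length u \<le> length w" using w by simp
  then obtain v' where "w = u @ v'" "v = v' @ y"
    using v(1) by (auto simp: append_eq_append_conv2)
  then show "u \<in> init_cuts Z M w"
    unfolding init_cuts_def using hereditaryD[OF mono, of "[]" u v' y] v by auto
qed

lemma term_cuts_append:
  assumes mono: "hereditary M"
    and fac: "factorial_set S" "x @ w \<in> S"
    and pre: "prefix_complete L S Z"
    and w: "L \<le> length w"
  shows "term_cuts Z M (x @ w) \<subseteq> term_cuts Z M w"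
proof
  fix v assume "v \<in> term_cuts Z M (x @ w)"
  then obtain u where v: "x @ w = u @ v" "M u v" "\<nexists>p. prefix p v \<and> p \<in> Z"
    unfolding term_cuts_def by blast
  have "v \<in> S" using factorial_suffixD[OF fac(1), of u v] fac(2) v by simp
  then have "length v < L" using prefix_completeD[OF pre] v(3) by (meson not_less)
  then have "length v \<le> length w" using w by simp
  then have "length x \<le> length u" using arg_cong[OF v(1), of length] by simp
  then obtain u' where "u = x @ u'" "w = u' @ v"
    using v(1) by (auto simp: append_eq_append_conv2)
  then show "v \<in> term_cuts Z M w"
    unfolding term_cuts_def using hereditaryD[OF mono, of x u' v "[]"] v by auto
qed

context bifix_coding
begin

text \<open>Once a word has length \<open>L\<close>, extension can only lose marked classes. Where
  their number is minimal it is constant under extension; by uniform recurrence this holds in all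
  long words, and equal cardinality forces equal sets of marked classes.\<close>

lemma cuts_stable:
  assumes ur: "uniformly_recurrent S"
    and pre: "prefix_complete L S Z"
    and suf: "suffix_complete L S Z"
    and inv: "cut_invariant Z M"
    and mono: "hereditary M"
  shows "\<exists>N. stable_from N S M"
proof -
  have fac: "factorial_set S" and ext: "right_extendable S" and "S \<noteq> {}"
    using ur unfolding uniformly_recurrent_def by auto
  define c where "c w = card (init_cuts Z M w)" for w
  have c_term: "c w = card (term_cuts Z M w)" for w
    unfolding c_def using card_init_term[OF inv] .
  have c_right: "c (w @ y) \<le> c w" if "w @ y \<in> S" "L \<le> length w" for w y
    unfolding c_def using init_cuts_append[OF mono fac that(1) suf that(2)]
    by (simp add: card_mono finite_init_cuts)
  have c_left: "c (x @ w) \<le> c w" if "x @ w \<in> S" "L \<le> length w" for w x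
    unfolding c_term using term_cuts_append[OF mono fac that(1) pre that(2)]
    by (simp add: card_mono finite_term_cuts)
  have "\<exists>w. w \<in> S \<and> L \<le> length w"
    using right_extend[OF ext, of _ L] \<open>S \<noteq> {}\<close> by fastforce
  then obtain w0 where w0: "w0 \<in> S" "L \<le> length w0"
    and min: "\<And>w. w \<in> S \<Longrightarrow> L \<le> length w \<Longrightarrow> c w0 \<le> c w"
    using ex_has_least_nat[of "\<lambda>w. w \<in> S \<and> L \<le> length w" _ c] by blast
  obtain n where n: "\<And>w. w \<in> S \<Longrightarrow> length w = n \<Longrightarrow> sublist w0 w"
    using ur w0 unfolding uniformly_recurrent_def by blast
  \<comment> \<open>Every word of length at least \<open>n\<close> contains \<open>w0\<close>, so
    monotonicity and minimality squeeze its count.\<close>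
  have const: "c w = c w0" "L \<le> length w" if w: "w \<in> S" "n \<le> length w" for w
  proof -
    have "take n w \<in> S" using factorial_prefixD[OF fac, of "take n w" "drop n w"] w by simp
    then have "sublist w0 (take n w)" using n w by simp
    then obtain x y where "take n w = x @ w0 @ y" unfolding sublist_def by blast
    then have wxy: "w = x @ w0 @ y @ drop n w" by (metis append_take_drop_id append.assoc)
    then show L: "L \<le> length w" using w0 by (metis length_append trans_le_add1 trans_le_add2)
    have "w0 @ y @ drop n w \<in> S"
      using factorial_suffixD[OF fac, of x] w wxy by simp
    moreover have "L \<le> length (w0 @ y @ drop n w)" using w0 by simp
    ultimately have "c w \<le> c w0"
      using c_left[of x "w0 @ y @ drop n w"] c_right[of w0 "y @ drop n w"] w wxy w0
      by (metis le_trans)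
    then show "c w = c w0" using min[OF w(1) L] by simp
  qed
  have right: "M u (v @ y)" if uvy: "u @ v @ y \<in> S" "n \<le> length (u @ v)" "M u v" for u v y
  proof -
    have uv: "u @ v \<in> S" using factorial_prefixD[OF fac, of "u @ v" y] uvy by simp
    have L: "L \<le> length (u @ v)" using const(2)[OF uv] uvy by simp
    have "init_cuts Z M ((u @ v) @ y) = init_cuts Z M (u @ v)"
    proof (rule card_subset_eq[OF finite_init_cuts])
      show "init_cuts Z M ((u @ v) @ y) \<subseteq> init_cuts Z M (u @ v)"
        using init_cuts_append[OF mono fac _ suf L] uvy by simp
      show "card (init_cuts Z M ((u @ v) @ y)) = card (init_cuts Z M (u @ v))"
        using const(1)[OF uv] const(1)[of "(u @ v) @ y"] uvy unfolding c_def by simp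
    qed
    \<comment> \<open>The mark at \<open>u\<close> is moved back to the first cut \<open>i\<close>
      of its class, which survives the extension, and then forward again.\<close>
    moreover obtain i r where i: "r \<in> lists B" "u = i @ enc r" "\<nexists>s. suffix s i \<and> s \<in> Z"
      using ex_enc_suffix by blast
    moreover have "M i (enc r @ v)"
      using cut_invariant_enc[OF inv i(1)] uvy(3) i(2) by simp
    then have "i \<in> init_cuts Z M (u @ v)"
      unfolding init_cuts_def using i by auto
    ultimately obtain v' where "(u @ v) @ y = i @ v'" "M i v'"
      unfolding init_cuts_def by blast
    then have "M i (enc r @ v @ y)" using i by simp
    then show ?thesis using cut_invariant_enc[OF inv i(1)] i(2) by simp
  qed
  have left: "M (x @ u) v" if xuv: "x @ u @ v \<in> S" "n \<le> length (u @ v)" "M u v" for x u v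
  proof -
    have uv: "u @ v \<in> S" using factorial_suffixD[OF fac, of x "u @ v"] xuv by simp
    have L: "L \<le> length (u @ v)" using const(2)[OF uv] xuv by simp
    have "term_cuts Z M (x @ (u @ v)) = term_cuts Z M (u @ v)"
    proof (rule card_subset_eq[OF finite_term_cuts])
      show "term_cuts Z M (x @ (u @ v)) \<subseteq> term_cuts Z M (u @ v)"
        using term_cuts_append[OF mono fac _ pre L] xuv by simp
      show "card (term_cuts Z M (x @ (u @ v))) = card (term_cuts Z M (u @ v))"
        using const(1)[OF uv] const(1)[of "x @ (u @ v)"] xuv unfolding c_term by simp
    qed
    moreover obtain r t where t: "r \<in> lists B" "v = enc r @ t" "\<nexists>p. prefix p t \<and> p \<in> Z"
      using ex_enc_prefix by blast
    moreover have "M (u @ enc r) t"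
      using cut_invariant_enc[OF inv t(1)] xuv(3) t(2) by simp
    then have "t \<in> term_cuts Z M (u @ v)"
      unfolding term_cuts_def using t by auto
    ultimately obtain u' where "x @ (u @ v) = u' @ t" "M u' t"
      unfolding term_cuts_def by blast
    then have "M ((x @ u) @ enc r) t" using t by simp
    then show ?thesis using cut_invariant_enc[OF inv t(1)] t(2) by metis
  qed
  have "M (x @ u) (v @ y)" if "n \<le> length (u @ v)" "x @ u @ v @ y \<in> S" "M u v" for x u v y
  proof -
    have "u @ v @ y \<in> S" using factorial_suffixD[OF fac, of x] that by simp
    then have "M u (v @ y)" using right that by blast
    then show ?thesis using left[of x u "v @ y"] that by simp
  qed
  then show ?thesis unfolding stable_from_def by blast
qed

section \<open>Decoding by a complete bifix code\<close>

definition decode :: "'a list set \<Rightarrow> 'b list set" where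
  "decode S = {t \<in> lists B. enc t \<in> S}"

lemma factorial_decode:
  assumes "factorial_set S" shows "factorial_set (decode S)"
  unfolding factorial_set_def
proof (intro ballI allI impI)
  fix w u assume "w \<in> decode S" "sublist u w"
  then obtain x y where "w = x @ u @ y" unfolding sublist_def by blast
  with \<open>w \<in> decode S\<close> have "u \<in> lists B" "enc x @ enc u @ enc y \<in> S"
    unfolding decode_def by simp_all
  then show "u \<in> decode S"
    using factorialD[OF assms] unfolding decode_def by blast
qed

text \<open>Any \<open>L\<close> letters following \<open>enc t\<close> begin with a codeword, which
  supplies the next letter of the decoded word.\<close>

lemma right_extendable_decode:
  assumes fac: "factorial_set S" and ext: "right_extendable S"
    and pre: "prefix_complete L S Z"
  shows "right_extendable (decode S)"
  unfolding right_extendable_def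
proof
  fix t assume t: "t \<in> decode S"
  then obtain y where y: "enc t @ y \<in> S" "length y = L"
    using right_extend[OF ext] unfolding decode_def by blast
  then have "y \<in> S" using factorial_suffixD[OF fac] by blast
  then obtain p where "prefix p y" "p \<in> Z" using prefix_completeD[OF pre] y by blast
  then obtain b y' where "b \<in> B" "y = g b @ y'" using g_obtain unfolding prefix_def by metis
  then show "\<exists>b. t @ [b] \<in> decode S"
    using t y factorial_prefixD[OF fac, of "enc t @ g b" y'] unfolding decode_def
    by (intro exI[of _ b]) simp
qed

lemma finite_alphabet: "finite Z \<Longrightarrow> finite B"
  using bij bij_betw_finite by blast

text \<open>Minimality in this form is uniform recurrence of \<open>decode S\<close> in disguise.
  Once every cut is marked, the mark in front of \<open>enc t\<close> places \<open>t\<close> inside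
  a word of \<open>K\<close>.\<close>

lemma decode_minimal:
  assumes fin: "finite Z" and ur: "uniformly_recurrent S"
    and conn: "connected_exts S"
    and pre: "prefix_complete L S Z"
    and suf: "suffix_complete L S Z"
    and K: "K \<subseteq> decode S" "factorial_set K" "infinite K"
  shows "decode S \<subseteq> K"
proof -
  have fac: "factorial_set S" and ext: "right_extendable S" and "S \<noteq> {}"
    using ur unfolding uniformly_recurrent_def by auto
  \<comment> \<open>The word \<open>u @ v\<close> occurs in the encoding of a word of
    \<open>K\<close> with the cut on a boundary between codewords.\<close>
  define M where "M u v \<longleftrightarrow> (\<exists>x y s t. x @ u = enc s \<and> v @ y = enc t \<and> s @ t \<in> K)" for u v
  have mono: "hereditary M"
    unfolding hereditary_def
  proof (intro allI impI)
    fix x u v y assume xuvy: "M (x @ u) (v @ y)"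
    obtain x' y' s t where "x' @ (x @ u) = enc s" "(v @ y) @ y' = enc t" "s @ t \<in> K"
      using xuvy unfolding M_def by blast
    then show "M u v" unfolding M_def
      by (intro exI[of _ "x' @ x"] exI[of _ "y @ y'"] exI[of _ s] exI[of _ t]) simp
  qed
  \<comment> \<open>Unitarity on both sides lets a codeword boundary move across
    \<open>z\<close>.\<close>
  have inv: "cut_invariant Z M"
    unfolding cut_invariant_def
  proof (intro allI ballI iffI)
    fix u v z assume "z \<in> Z"
    then obtain b where b: "b \<in> B" "z = enc [b]" by (metis append_Nil2 enc_simps(1,2) g_obtain)
    {
      assume "M u (z @ v)"
      then obtain x y s t where *: "x @ u = enc s" "enc [b] @ v @ y = enc t" "s @ t \<in> K"
        unfolding M_def b by auto
      then have "t \<in> lists B" using K(1) unfolding decode_def by auto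
      then obtain r where "t = [b] @ r" "v @ y = enc r"
        using enc_right_unitary[of "[b]" t "v @ y"] b(1) *(2) by (metis lists.Cons lists.Nil)
      then show "M (u @ z) v" unfolding M_def b using *
        by - (rule exI[of _ x], rule exI[of _ y], rule exI[of _ "s @ [b]"], rule exI[of _ r], simp)
    }
    {
      assume "M (u @ z) v"
      then obtain x y s t where *: "(x @ u) @ enc [b] = enc s" "v @ y = enc t" "s @ t \<in> K"
        unfolding M_def b by auto
      then have "s \<in> lists B" using K(1) unfolding decode_def by auto
      then obtain r where "s = r @ [b]" "x @ u = enc r"
        using enc_left_unitary[of "[b]" s "x @ u"] b(1) *(1) by (metis lists.Cons lists.Nil)
      then show "M u (z @ v)" unfolding M_def b using *
        by (intro exI[of _ x] exI[of _ y] exI[of _ r] exI[of _ "[b] @ t"]) simp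
    }
  qed
  obtain m where m: "\<And>z. z \<in> Z \<Longrightarrow> length z \<le> m"
    using finite_nat_set_iff_bounded_le[of "length ` Z"] fin by auto
  \<comment> \<open>Infinitely many words over the finite alphabet \<open>B\<close> include
    arbitrarily long ones; the encoding of a long one contains \<open>w\<close>, and
    \<open>w\<close> has room for a codeword boundary.\<close>
  have occ: "\<exists>u v. w = u @ v \<and> M u v" if w: "w \<in> S" "m \<le> length w" for w
  proof -
    obtain n where n: "\<And>w'. w' \<in> S \<Longrightarrow> length w' = n \<Longrightarrow> sublist w w'"
      using ur w unfolding uniformly_recurrent_def by blast
    have "\<not> K \<subseteq> {t. set t \<subseteq> B \<and> length t \<le> n}"
      using K(3) finite_lists_length_le[OF finite_alphabet[OF fin]] finite_subset by blast
    then obtain t where "t \<in> K" and long: "\<not> (set t \<subseteq> B \<and> length t \<le> n)" by blast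
    then have t: "t \<in> K" "t \<in> lists B" "enc t \<in> S" using K(1) unfolding decode_def by auto
    then have "n \<le> length t" using long by auto
    also have "\<dots> \<le> length (enc t)" using length_enc t by blast
    finally have "length (take n (enc t)) = n" using t by simp
    moreover have "take n (enc t) \<in> S"
      using factorial_prefixD[OF fac, of "take n (enc t)" "drop n (enc t)"] t by simp
    ultimately have "sublist w (take n (enc t))" using n by blast
    then have "sublist w (enc t)"
      using sublist_take sublist_order.order_trans by blast
    then obtain x y where "enc t = x @ w @ y" unfolding sublist_def by blast
    then show ?thesis
      using enc_cut[of w t x y] m w(2) t(1,2) unfolding M_def by (metis le_trans)
  qed
  obtain N where N: "stable_from N S M"
    using cuts_stable[OF ur pre suf inv mono] by blast
  \<comment> \<open>\<open>m\<close> letters guarantee a marked cut and \<open>N\<close> letters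
    make it stable.\<close>
  obtain w where w: "w \<in> S" "N + m \<le> length w"
  proof -
    obtain w0 where "w0 \<in> S" using \<open>S \<noteq> {}\<close> by blast
    then obtain y where "w0 @ y \<in> S" "length y = N + m" using right_extend[OF ext] by blast
    then show thesis using that by simp
  qed
  then obtain u v where uv: "u @ v \<in> S" "N \<le> length (u @ v)" "M u v"
    using occ[of w] by auto
  show ?thesis
  proof
    fix t assume t: "t \<in> decode S"
    then have "M [] (enc t)"
      using connected_propagate[OF fac ext conn mono N uv, of "[]" "enc t"] unfolding decode_def by simp
    then obtain y s t' where "enc t @ y = enc t'" "s @ t' \<in> K" unfolding M_def by blast
    moreover from this have "t' \<in> lists B" using K(1) unfolding decode_def by auto
    ultimately obtain r where "s @ t @ r \<in> K"
      using enc_right_unitary[of t t' y] t unfolding decode_def by blast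
    then show "t \<in> K" using factorialD[OF K(2)] by blast
  qed
qed

text \<open>The words of \<open>decode S\<close> avoiding \<open>u\<close> form a factorial set that
  misses \<open>u\<close>, so they are finitely many, and any length beyond the longest of them is a
  window for \<open>u\<close>.\<close>

lemma uniformly_recurrent_decode:
  assumes fin: "finite Z" and ur: "uniformly_recurrent S"
    and conn: "connected_exts S"
    and pre: "prefix_complete L S Z"
    and suf: "suffix_complete L S Z"
  shows "uniformly_recurrent (decode S)"
proof -
  have fac: "factorial_set S" and ext: "right_extendable S" and "S \<noteq> {}"
    using ur unfolding uniformly_recurrent_def by auto
  have "[] \<in> S" using \<open>S \<noteq> {}\<close> factorial_prefixD[OF fac, of "[]"] by auto
  then have ne: "decode S \<noteq> {}" unfolding decode_def by (auto intro!: exI[of _ "[]"])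
  note facT = factorial_decode[OF fac]
  note extT = right_extendable_decode[OF fac ext pre]
  have "\<exists>n\<ge>1. \<forall>w\<in>decode S. length w = n \<longrightarrow> sublist u w" if u: "u \<in> decode S" for u
  proof -
    define K where "K = {t \<in> decode S. \<not> sublist u t}"
    have "factorial_set K"
      using facT unfolding factorial_set_def K_def by (auto intro: sublist_order.order_trans)
    moreover have "\<not> decode S \<subseteq> K" using u unfolding K_def by auto
    moreover have "K \<subseteq> decode S" unfolding K_def by blast
    ultimately have "finite K"
      using decode_minimal[OF fin ur conn pre suf, where K = K] by blast
    then obtain n where "\<And>t. t \<in> K \<Longrightarrow> length t \<le> n"
      using finite_nat_set_iff_bounded_le[of "length ` K"] by auto
    then have "\<forall>w\<in>decode S. length w = Suc n \<longrightarrow> sublist u w"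
      unfolding K_def by fastforce
    then show ?thesis by (intro exI[of _ "Suc n"]) simp
  qed
  then show ?thesis
    unfolding uniformly_recurrent_def using ne facT extT by blast
qed

end

section \<open>Maximal bifix codes and completeness\<close>

text \<open>Maximality is exchanged for this condition because it concerns only the two ends of long
  words and can be passed between \<open>S\<close> and the decoded set.\<close>

definition complete_bifix :: "'a list set \<Rightarrow> 'a list set \<Rightarrow> bool" where
  "complete_bifix S X \<longleftrightarrow> bifix_code X \<and> (\<exists>L. prefix_complete L S X \<and> suffix_complete L S X)"

lemma bifix_coding_self: "bifix_code X \<Longrightarrow> bifix_coding X (\<lambda>x. x) X"
  by unfold_locales (auto simp: bij_betw_def)

abbreviation inits :: "'a list set \<Rightarrow> 'a list \<Rightarrow> 'a list set" where
  "inits X w \<equiv> init_cuts X (\<lambda>_ _. True) w"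

abbreviation terms :: "'a list set \<Rightarrow> 'a list \<Rightarrow> 'a list set" where
  "terms X w \<equiv> term_cuts X (\<lambda>_ _. True) w"

lemma card_parses_inits: "bifix_code X \<Longrightarrow> card (parses X w) = card (inits X w)"
  using bij_betw_same_card[OF bifix_coding.bij_parses_init[OF bifix_coding_self, of X w "\<lambda>_ _. True"]]
  by simp

lemma card_inits_terms: "bifix_code X \<Longrightarrow> card (inits X w) = card (terms X w)"
  by (rule bifix_coding.card_init_term[OF bifix_coding_self]) (simp_all add: cut_invariant_def)

lemma inits_append: "inits X w \<subseteq> inits X (w @ y)"
  unfolding init_cuts_def by auto

lemma terms_append: "terms X w \<subseteq> terms X (x @ w)"
  unfolding term_cuts_def by auto

text \<open>First cuts persist under right extension and last cuts under left extension; both count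
  the parses, so the two extensions can be done in turn.\<close>

lemma card_parses_mono:
  assumes "bifix_code X"
  shows "card (parses X w) \<le> card (parses X (x @ w @ y))"
proof -
  have "card (inits X w) \<le> card (inits X (w @ y))"
    by (rule card_mono[OF finite_init_cuts inits_append])
  also have "\<dots> = card (terms X (w @ y))"
    by (rule card_inits_terms[OF assms])
  also have "\<dots> \<le> card (terms X (x @ w @ y))"
    by (rule card_mono[OF finite_term_cuts terms_append])
  finally show ?thesis
    by (simp add: card_parses_inits[OF assms] card_inits_terms[OF assms])
qed

text \<open>Unlike \<open>uniformly_recurrent\<close>, which asks for extension to the right, this
  property is visibly invariant under reversal.\<close>

definition recurrent :: "'a list set \<Rightarrow> bool" where
  "recurrent S \<longleftrightarrow> (\<forall>u\<in>S. \<forall>v\<in>S. \<exists>w. u @ w @ v \<in> S)"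

lemma uniformly_recurrent_imp_recurrent:
  assumes "uniformly_recurrent S"
  shows "recurrent S"
  unfolding recurrent_def
proof (intro ballI)
  fix u v assume uv: "u \<in> S" "v \<in> S"
  have fac: "factorial_set S" and ext: "right_extendable S"
    using assms unfolding uniformly_recurrent_def by auto
  obtain n where n: "\<And>w. w \<in> S \<Longrightarrow> length w = n \<Longrightarrow> sublist v w"
    using assms uv unfolding uniformly_recurrent_def by blast
  obtain y where y: "u @ y \<in> S" "length y = n" using right_extend[OF ext uv(1)] by blast
  then have "sublist v y" using n factorial_suffixD[OF fac] by blast
  then obtain a b where "y = a @ v @ b" unfolding sublist_def by blast
  then show "\<exists>w. u @ w @ v \<in> S"
    using y factorial_prefixD[OF fac, of "u @ a @ v" b] by auto
qed

lemma finite_length_bound: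
  assumes "finite X"
  obtains m where "\<And>x. x \<in> X \<Longrightarrow> length x \<le> m"
  using finite_nat_set_iff_bounded_le[of "length ` X"] assms by auto

text \<open>A remainder without codeword prefix has length below \<open>m\<close>, and suffixes of
  one word are told apart by their lengths.\<close>

lemma card_terms_le:
  assumes "factorial_set S" "w \<in> S"
    and pre: "prefix_complete m S X"
  shows "card (terms X w) \<le> m"
proof -
  have "inj_on length (terms X w)"
  proof (rule inj_onI)
    fix u v assume "u \<in> terms X w" "v \<in> terms X w" and len: "length u = length v"
    then obtain u' v' where "w = u' @ u" "w = v' @ v" unfolding term_cuts_def by blast
    then show "u = v" using len by (metis append_eq_append_conv)
  qed
  moreover have "length ` terms X w \<subseteq> {..<m}"
  proof (rule image_subsetI)
    fix v assume "v \<in> terms X w"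
    then obtain u where u: "w = u @ v" "\<nexists>p. prefix p v \<and> p \<in> X" unfolding term_cuts_def by blast
    then have "v \<in> S" using factorial_suffixD assms(1,2) by metis
    then have "\<not> m \<le> length v" using prefix_completeD[OF pre] u(2) by blast
    then show "length v \<in> {..<m}" by simp
  qed
  ultimately show ?thesis
    using card_inj_on_le[of length "terms X w" "{..<m}"] by simp
qed

text \<open>
  A word with the maximal number of parses gets no new initial cut when extended to the right,
  so every word strictly extending it ends with a codeword.
\<close>

lemma prefix_comparable_imp_suffix:
  assumes fac: "factorial_set S" and rec: "recurrent S"
    and X: "bifix_code X" and m: "length ` X \<subseteq> {..m}"
    and pre: "prefix_complete m S X"
    and u: "u \<in> S" "Suc m \<le> length u"
  shows "\<exists>s. suffix s u \<and> s \<in> X"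
proof -
  have bound: "\<forall>w. w \<in> S \<longrightarrow> card (inits X w) < Suc m"
    using card_terms_le[OF fac _ pre] card_inits_terms[OF X] by (metis less_Suc_eq_le)
  then obtain w where w: "w \<in> S" "\<And>w'. w' \<in> S \<Longrightarrow> card (inits X w') \<le> card (inits X w)"
    using ex_has_greatest_nat[of "\<lambda>w. w \<in> S" u "\<lambda>w. card (inits X w)" "Suc m"] u by auto
  obtain v where v: "w @ v @ u \<in> S" using rec w u unfolding recurrent_def by blast
  have "inits X w = inits X (w @ v @ u)"
    using card_subset_eq[OF finite_init_cuts inits_append] w(2)[OF v]
      card_mono[OF finite_init_cuts inits_append, of X w "v @ u"] by (metis le_antisym)
  \<comment> \<open>The bound \<open>Suc m\<close> makes \<open>u\<close> nonempty, so
    \<open>w @ v @ u\<close> is longer than \<open>w\<close>.\<close>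
  moreover have "w @ v @ u \<notin> inits X w"
    using u unfolding init_cuts_def by auto
  ultimately have "w @ v @ u \<notin> inits X (w @ v @ u)" by simp
  then obtain s where s: "suffix s (w @ v @ u)" "s \<in> X"
    unfolding init_cuts_def by auto
  moreover have "suffix u (w @ v @ u)" by (simp add: suffix_def)
  \<comment> \<open>Codewords have length at most \<open>m\<close>, so the suffix found does not
    reach beyond \<open>u\<close>.\<close>
  moreover have "length s \<le> length u" using m s(2) u by fastforce
  ultimately show ?thesis using suffix_length_suffix by blast
qed

section \<open>Left-right symmetry by reversal\<close>

lemma prefix_code_rev: "prefix_code (rev ` X) \<longleftrightarrow> suffix_code X"
  unfolding prefix_code_def suffix_code_def strict_prefix_def strict_suffix_def suffix_to_prefix
  by (auto simp: image_iff)

lemma suffix_code_rev: "suffix_code (rev ` X) \<longleftrightarrow> prefix_code X"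
  using prefix_code_rev[of "rev ` X"] by (simp add: image_image)

lemma bifix_code_rev: "bifix_code (rev ` X) \<longleftrightarrow> bifix_code X"
  unfolding bifix_code_def prefix_code_rev suffix_code_rev by blast

lemma factorial_rev: "factorial_set S \<Longrightarrow> factorial_set (rev ` S)"
  unfolding factorial_set_def by (auto simp: image_iff sublist_rev_right) (metis rev_rev_ident)

lemma recurrent_rev: "recurrent S \<Longrightarrow> recurrent (rev ` S)"
  unfolding recurrent_def
proof (intro ballI)
  fix u v assume rec: "\<forall>u\<in>S. \<forall>v\<in>S. \<exists>w. u @ w @ v \<in> S" and "u \<in> rev ` S" "v \<in> rev ` S"
  then have "rev u \<in> S" "rev v \<in> S" by auto
  then obtain w where "rev v @ w @ rev u \<in> S" using rec by blast
  then have "rev (rev v @ w @ rev u) \<in> rev ` S" by blast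
  then show "\<exists>w. u @ w @ v \<in> rev ` S" by auto
qed

text \<open>Reversal exchanges prefixes with suffixes and preserves \<open>factorial_set\<close>,
  \<open>recurrent\<close> and \<open>bifix_code\<close>, so the one-sided argument applies to the
  mirror images.\<close>

lemma suffix_comparable_imp_prefix:
  assumes fac: "factorial_set S" and rec: "recurrent S"
    and X: "bifix_code X" and m: "length ` X \<subseteq> {..m}"
    and suf: "suffix_complete m S X"
    and u: "u \<in> S" "Suc m \<le> length u"
  shows "\<exists>p. prefix p u \<and> p \<in> X"
proof -
  have "\<exists>s. suffix s (rev u) \<and> s \<in> rev ` X"
  proof (rule prefix_comparable_imp_suffix[OF factorial_rev[OF fac] recurrent_rev[OF rec]])
    have "\<exists>p. prefix p w \<and> p \<in> rev ` X" if "w \<in> rev ` S" "m \<le> length w" for w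
    proof -
      have "rev w \<in> S" "m \<le> length (rev w)" using that by auto
      then obtain s where "suffix s (rev w)" "s \<in> X" using suffix_completeD[OF suf] by blast
      then show ?thesis unfolding suffix_to_prefix rev_rev_ident by blast
    qed
    then show "prefix_complete m (rev ` S) (rev ` X)" unfolding prefix_complete_def by blast
    show "bifix_code (rev ` X)" using X by (simp add: bifix_code_rev)
    show "length ` rev ` X \<subseteq> {..m}" using m by (simp add: image_image)
  qed (use u in simp_all)
  then obtain p where "suffix (rev p) (rev u)" "p \<in> X" by blast
  then show ?thesis unfolding suffix_to_prefix rev_rev_ident by blast
qed

section \<open>Maximality and completeness of finite bifix codes\<close>

lemma maximal_imp_complete:
  assumes ur: "uniformly_recurrent S" and fin: "finite X" and max: "maximal_bifix_code S X"
  shows "complete_bifix S X"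
proof -
  have fac: "factorial_set S" and ext: "right_extendable S"
    using ur unfolding uniformly_recurrent_def by auto
  note rec = uniformly_recurrent_imp_recurrent[OF ur]
  have X: "bifix_code X" "X \<subseteq> S" using max unfolding maximal_bifix_code_def by auto
  obtain m where m: "\<And>x. x \<in> X \<Longrightarrow> length x \<le> m" using finite_length_bound[OF fin] by blast
  then have mX: "length ` X \<subseteq> {..m}" by auto
  \<comment> \<open>If prefix-comparability fails at \<open>u\<close> and suffix-comparability at
    \<open>v\<close>, a word of \<open>S\<close> that starts with \<open>u\<close> and ends with
    \<open>v\<close> can be added to the code. Otherwise comparability on one side yields
    completeness there, and then on the other side.\<close>
  consider "\<And>w. w \<in> S \<Longrightarrow> \<exists>x\<in>X. prefix x w \<or> prefix w x" | "\<And>w. w \<in> S \<Longrightarrow> \<exists>x\<in>X. suffix x w \<or> suffix w x"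
    | u v where "u \<in> S" "v \<in> S" "\<And>x. x \<in> X \<Longrightarrow> \<not> prefix x u \<and> \<not> prefix u x"
      "\<And>x. x \<in> X \<Longrightarrow> \<not> suffix x v \<and> \<not> suffix v x"
    by blast
  then show ?thesis
  proof cases
    case 1
    have "\<exists>p. prefix p w \<and> p \<in> X" if w: "w \<in> S" "m \<le> length w" for w
    proof -
      obtain x where x: "x \<in> X" "prefix x w \<or> prefix w x" using 1 w by blast
      have "length x \<le> length w" using m[OF x(1)] w(2) by simp
      then have "prefix x w" using x(2) by (auto simp: prefix_def)
      then show ?thesis using x by blast
    qed
    then have pre: "prefix_complete m S X" unfolding prefix_complete_def by blast
    then have "prefix_complete (Suc m) S X" unfolding prefix_complete_def by auto
    moreover have "suffix_complete (Suc m) S X"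
      using prefix_comparable_imp_suffix[OF fac rec X(1) mX pre] unfolding suffix_complete_def by blast
    ultimately show ?thesis unfolding complete_bifix_def using X(1) by blast
  next
    case 2
    have "\<exists>p. suffix p w \<and> p \<in> X" if w: "w \<in> S" "m \<le> length w" for w
    proof -
      obtain x where x: "x \<in> X" "suffix x w \<or> suffix w x" using 2 w by blast
      have "length x \<le> length w" using m[OF x(1)] w(2) by simp
      then have "suffix x w" using x(2) by (auto simp: suffix_def)
      then show ?thesis using x by blast
    qed
    then have suf: "suffix_complete m S X" unfolding suffix_complete_def by blast
    then have "suffix_complete (Suc m) S X" unfolding suffix_complete_def by auto
    moreover have "prefix_complete (Suc m) S X"
      using suffix_comparable_imp_prefix[OF fac rec X(1) mX suf] unfolding prefix_complete_def by blast
    ultimately show ?thesis unfolding complete_bifix_def using X(1) by blast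
  next
    case (3 u v)
    \<comment> \<open>The letter \<open>a\<close> keeps the new codeword nonempty even if
      \<open>X\<close> is empty and \<open>u = v = []\<close>.\<close>
    obtain a where "u @ [a] \<in> S" using 3(1) ext unfolding right_extendable_def by blast
    then obtain w where w: "(u @ [a]) @ w @ v \<in> S" using rec 3(2) unfolding recurrent_def by blast
    define t where "t = (u @ [a]) @ w @ v"
    have t: "\<not> prefix x t \<and> \<not> prefix t x \<and> \<not> suffix x t \<and> \<not> suffix t x" if x: "x \<in> X" for x
    proof -
      have ut: "prefix u t" "suffix v t" unfolding t_def by (auto simp: suffix_def)
      have "\<not> prefix x t" using 3(3)[OF x] prefix_same_cases[OF _ ut(1)] by blast
      moreover have "\<not> prefix t x" using 3(3)[OF x] prefix_order.order_trans[OF ut(1)] by blast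
      moreover have "\<not> suffix x t" using 3(4)[OF x] suffix_same_cases[OF _ ut(2)] by blast
      moreover have "\<not> suffix t x" using 3(4)[OF x] suffix_order.order_trans[OF ut(2)] by blast
      ultimately show ?thesis by blast
    qed
    have "t \<noteq> []" unfolding t_def by simp
    moreover have "prefix_code X" "suffix_code X" using X(1) unfolding bifix_code_def by simp_all
    ultimately have "prefix_code (insert t X)" "suffix_code (insert t X)"
      using t unfolding prefix_code_def suffix_code_def strict_prefix_def strict_suffix_def by blast+
    then have "bifix_code (insert t X)" unfolding bifix_code_def by simp
    moreover have "X \<subset> insert t X" using t[of t] by auto
    moreover have "insert t X \<subseteq> S" using X w unfolding t_def by simp
    ultimately have False using max unfolding maximal_bifix_code_def by blast
    then show ?thesis ..
  qed
qed

text \<open>A word added to \<open>X\<close> would be prefix-comparable with a word of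
  \<open>X\<close>, which no larger prefix code allows.\<close>

lemma prefix_comparable_imp_maximal:
  assumes "bifix_code X" "X \<subseteq> S"
    and cmp: "\<And>w. w \<in> S \<Longrightarrow> \<exists>x\<in>X. prefix x w \<or> prefix w x"
  shows "maximal_bifix_code S X"
proof -
  have False if X': "bifix_code X'" "X' \<subseteq> S" "X \<subset> X'" for X'
  proof -
    obtain t where t: "t \<in> X'" "t \<notin> X" using X' by blast
    then obtain x where "x \<in> X" "prefix x t \<or> prefix t x" using cmp X' by blast
    then show False
      using X' t unfolding bifix_code_def prefix_code_def strict_prefix_def by blast
  qed
  then show ?thesis using assms unfolding maximal_bifix_code_def by blast
qed

lemma complete_imp_maximal:
  assumes ext: "right_extendable S" and X: "complete_bifix S X" "X \<subseteq> S"
  shows "maximal_bifix_code S X"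
proof (rule prefix_comparable_imp_maximal)
  obtain L where L: "prefix_complete L S X"
    using X unfolding complete_bifix_def by blast
  fix w assume "w \<in> S"
  then obtain y where "w @ y \<in> S" "length y = L" using right_extend[OF ext] by blast
  then obtain p where "prefix p (w @ y)" "p \<in> X" using prefix_completeD[OF L, of "w @ y"] by auto
  then show "\<exists>x\<in>X. prefix x w \<or> prefix w x" using prefix_same_cases[of p "w @ y" w] by auto
qed (use X in \<open>auto simp: complete_bifix_def\<close>)

section \<open>The degree as the eventual number of parses\<close>

lemma code_degree_eqI:
  assumes ur: "uniformly_recurrent S" and X: "bifix_code X"
    and d: "\<And>w. w \<in> S \<Longrightarrow> N \<le> length w \<Longrightarrow> card (parses X w) = d"
  shows "code_degree S X = enat d"
proof -
  have ext: "right_extendable S" and ne: "S \<noteq> {}"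
    using ur unfolding uniformly_recurrent_def by auto
  have long: "\<exists>y. w @ y \<in> S \<and> card (parses X (w @ y)) = d" if "w \<in> S" for w
    using right_extend[OF ext that, of N] d by (metis le_add2 length_append)
  \<comment> \<open>Parse counts grow with extension, so the eventual value \<open>d\<close> bounds
    the counts of short words too.\<close>
  have "card (parses X w) \<le> d" if w: "w \<in> S" for w
    using long[OF w] card_parses_mono[OF X, of w "[]"] by auto
  moreover have "\<exists>w\<in>S. card (parses X w) = d" using long ne by blast
  ultimately show ?thesis
    unfolding code_degree_def by (intro antisym SUP_least) (auto intro: SUP_upper2)
qed

text \<open>Completeness bounds the number of parses by \<open>L\<close>. A word with the most
  parses occurs in every long enough word, which then has equally many.\<close>

lemma complete_degree:
  assumes ur: "uniformly_recurrent S" and X: "complete_bifix S X"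
  obtains d N where "code_degree S X = enat d"
    "\<And>w. w \<in> S \<Longrightarrow> N \<le> length w \<Longrightarrow> card (parses X w) = d"
proof -
  have fac: "factorial_set S" and ne: "S \<noteq> {}"
    using ur unfolding uniformly_recurrent_def by auto
  have bX: "bifix_code X" using X unfolding complete_bifix_def by blast
  obtain L where L: "prefix_complete L S X"
    using X unfolding complete_bifix_def by blast
  have "\<forall>w. w \<in> S \<longrightarrow> card (parses X w) < Suc L"
    using card_terms_le[OF fac _ L] card_inits_terms[OF bX] card_parses_inits[OF bX]
    by (metis less_Suc_eq_le)
  moreover obtain w0 where "w0 \<in> S" using ne by blast
  ultimately obtain w where w: "w \<in> S" "\<And>w'. w' \<in> S \<Longrightarrow> card (parses X w') \<le> card (parses X w)"
    using ex_has_greatest_nat[of "\<lambda>w. w \<in> S" w0 "\<lambda>w. card (parses X w)" "Suc L"] by auto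
  obtain n where n: "\<And>w'. w' \<in> S \<Longrightarrow> length w' = n \<Longrightarrow> sublist w w'"
    using ur w unfolding uniformly_recurrent_def by blast
  have "card (parses X w') = card (parses X w)" if w': "w' \<in> S" "n \<le> length w'" for w'
  proof -
    have "take n w' \<in> S" using factorial_prefixD[OF fac, of "take n w'" "drop n w'"] w' by simp
    then have "sublist w (take n w')" using n w' by simp
    then have "sublist w w'" using sublist_take sublist_order.order_trans by blast
    then obtain x y where "w' = x @ w @ y" unfolding sublist_def by blast
    then show ?thesis using card_parses_mono[OF bX, of w x y] w(2)[OF w'(1)] by simp
  qed
  then show thesis using that code_degree_eqI[OF ur bX] by blast
qed

section \<open>Composition\<close>

context bifix_coding
begin

lemma bifix_code_of_enc:
  assumes Y: "Y \<subseteq> lists B" and X: "bifix_code (enc ` Y)"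
  shows "bifix_code Y"
proof -
  have ne: "[] \<notin> Y"
    using X unfolding bifix_code_def prefix_code_def by force
  have "\<not> strict_prefix y x" if xy: "x \<in> Y" "y \<in> Y" for x y
  proof
    assume "strict_prefix y x"
    then have "prefix (enc y) (enc x)" "y \<noteq> x" unfolding strict_prefix_def prefix_def by auto
    moreover from this have "enc y \<noteq> enc x" using enc_inj[of y x] xy Y by blast
    ultimately show False
      using X xy unfolding bifix_code_def prefix_code_def strict_prefix_def by blast
  qed
  moreover have "\<not> strict_suffix y x" if xy: "x \<in> Y" "y \<in> Y" for x y
  proof
    assume "strict_suffix y x"
    then have "suffix (enc y) (enc x)" "y \<noteq> x" unfolding strict_suffix_def suffix_def by auto
    moreover from this have "enc y \<noteq> enc x" using enc_inj[of y x] xy Y by blast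
    ultimately show False
      using X xy unfolding bifix_code_def suffix_code_def strict_suffix_def by blast
  qed
  ultimately show ?thesis
    using ne unfolding bifix_code_def prefix_code_def suffix_code_def by blast
qed

lemma prefix_of_enc:
  assumes "s \<in> lists B" "t \<in> lists B" "prefix (enc s) (enc t)"
  shows "prefix s t"
  using assms enc_right_unitary[of s t] unfolding prefix_def by metis

lemma suffix_of_enc:
  assumes "s \<in> lists B" "t \<in> lists B" "suffix (enc s) (enc t)"
  shows "suffix s t"
  using assms enc_left_unitary[of s t] unfolding suffix_def by metis

text \<open>Each encoded word of \<open>Y\<close> begins and ends with a word of \<open>Z\<close>,
  so the completeness bound is inherited.\<close>

lemma complete_outer:
  assumes Y: "Y \<subseteq> lists B" and X: "complete_bifix S (enc ` Y)"
  shows "complete_bifix S Z"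
proof -
  obtain L where L: "prefix_complete L S (enc ` Y)" "suffix_complete L S (enc ` Y)"
    using X unfolding complete_bifix_def by blast
  have ne: "[] \<notin> Y"
    using X unfolding complete_bifix_def bifix_code_def prefix_code_def by force
  have "\<exists>p. prefix p w \<and> p \<in> Z" if w: "w \<in> S" "L \<le> length w" for w
  proof -
    obtain y where y: "y \<in> Y" "prefix (enc y) w" using prefix_completeD[OF L(1) w] by blast
    then obtain b y' where "y = b # y'" "b \<in> B" using ne Y by (cases y) auto
    then have "g b \<in> Z" "prefix (g b) w" using g_in y(2) by (auto simp: prefix_def)
    then show ?thesis by blast
  qed
  moreover have "\<exists>s. suffix s w \<and> s \<in> Z" if w: "w \<in> S" "L \<le> length w" for w
  proof -
    obtain y where y: "y \<in> Y" "suffix (enc y) w" using suffix_completeD[OF L(2) w] by blast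
    then obtain b y' where "y = y' @ [b]" "b \<in> B" using ne Y by (cases y rule: rev_cases) auto
    then have "g b \<in> Z" "suffix (g b) w" using g_in y(2) by (auto simp: suffix_def)
    then show ?thesis by blast
  qed
  ultimately show ?thesis
    unfolding complete_bifix_def prefix_complete_def suffix_complete_def using bifix by blast
qed

text \<open>Encoding does not shorten a word, so the bound \<open>L\<close> carries over, and
  unitarity turns a prefix or suffix of the encoding back into one of the word.\<close>

lemma complete_inner:
  assumes Y: "Y \<subseteq> lists B" and X: "complete_bifix S (enc ` Y)"
  shows "complete_bifix (decode S) Y"
proof -
  obtain L where L: "prefix_complete L S (enc ` Y)" "suffix_complete L S (enc ` Y)"
    using X unfolding complete_bifix_def by blast
  have long: "t \<in> lists B" "enc t \<in> S" "L \<le> length (enc t)" if "t \<in> decode S" "L \<le> length t" for t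
    using that length_enc[of t] unfolding decode_def by auto
  have "prefix_complete L (decode S) Y"
    unfolding prefix_complete_def
  proof (intro ballI impI)
    fix t assume "t \<in> decode S" "L \<le> length t"
    note t = long[OF this]
    obtain y where "y \<in> Y" "prefix (enc y) (enc t)" using prefix_completeD[OF L(1) t(2,3)] by blast
    then show "\<exists>p. prefix p t \<and> p \<in> Y" using prefix_of_enc[of y t] Y t(1) by blast
  qed
  moreover have "suffix_complete L (decode S) Y"
    unfolding suffix_complete_def
  proof (intro ballI impI)
    fix t assume "t \<in> decode S" "L \<le> length t"
    note t = long[OF this]
    obtain y where "y \<in> Y" "suffix (enc y) (enc t)" using suffix_completeD[OF L(2) t(2,3)] by blast
    then show "\<exists>s. suffix s t \<and> s \<in> Y" using suffix_of_enc[of y t] Y t(1) by blast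
  qed
  ultimately show ?thesis
    using bifix_code_of_enc[OF Y] X unfolding complete_bifix_def by blast
qed

lemma length_enc_le:
  assumes "\<And>z. z \<in> Z \<Longrightarrow> length z \<le> m" "t \<in> lists B"
  shows "length (enc t) \<le> m * length t"
  using assms(2)
proof (induction t)
  case (Cons b t)
  then show ?case using assms(1)[OF g_in, of b] by simp
qed simp

text \<open>Long words of \<open>S\<close> decode, up to a short remainder, to long words of
  \<open>decode S\<close>, which begin with a word of \<open>Y\<close>; this gives the
  prefix-comparability from which maximality follows.\<close>

lemma maximal_compose:
  assumes fac: "factorial_set S" and ext: "right_extendable S" and fin: "finite Z"
    and Z: "complete_bifix S Z" and Y: "complete_bifix (decode S) Y" "Y \<subseteq> lists B"
    and X: "bifix_code (enc ` Y)" "enc ` Y \<subseteq> S"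
  shows "maximal_bifix_code S (enc ` Y)"
proof (rule prefix_comparable_imp_maximal[OF X])
  obtain L where L: "prefix_complete L S Z" using Z unfolding complete_bifix_def by blast
  obtain K where K: "prefix_complete K (decode S) Y" using Y unfolding complete_bifix_def by blast
  obtain m where m: "\<And>z. z \<in> Z \<Longrightarrow> length z \<le> m" using finite_length_bound[OF fin] by blast
  fix w assume "w \<in> S"
  \<comment> \<open>Decoding leaves fewer than \<open>L\<close> letters over, and a letter of
    \<open>t\<close> stands for at most \<open>m\<close> letters, so \<open>t\<close> has at least
    \<open>K\<close> letters.\<close>
  then obtain y where y: "w @ y \<in> S" "length y = L + m * K" using right_extend[OF ext] by blast
  obtain t v where t: "t \<in> lists B" "w @ y = enc t @ v" "\<nexists>p. prefix p v \<and> p \<in> Z"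
    using ex_enc_prefix by blast
  have tv: "enc t \<in> S" "v \<in> S"
    using factorial_prefixD[OF fac, of "enc t" v] factorial_suffixD[OF fac, of "enc t" v] y t by auto
  have "length v < L" using prefix_completeD[OF L tv(2)] t(3) by (meson not_less)
  moreover have "length w + length y = length (enc t) + length v"
    using arg_cong[OF t(2), of length] by simp
  ultimately have "m * K < length (enc t)" using y(2) by simp
  also have "\<dots> \<le> m * length t" using length_enc_le[OF m t(1)] .
  finally have "K \<le> length t" by simp
  then obtain x where x: "x \<in> Y" "prefix x t"
    using prefix_completeD[OF K, of t] t(1) tv(1) unfolding decode_def by blast
  then have "prefix (enc x) (w @ y)" using t(2) by (auto simp: prefix_def)
  then have "prefix (enc x) w \<or> prefix w (enc x)" using prefix_same_cases[of "enc x" "w @ y" w] by simp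
  then show "\<exists>x\<in>enc ` Y. prefix x w \<or> prefix w x" using x by blast
qed

text \<open>
  The initial cuts of a word for the composed code are sorted by the cut class with respect to
  \<open>Z\<close> that they belong to: inside the class starting after \<open>i\<close> they are the initial cuts of the
  decoded word \<open>t i\<close> with respect to \<open>Y\<close>.
\<close>

lemma card_inits_compose:
  assumes Y: "Y \<subseteq> lists B"
    and t: "\<And>i. i \<in> inits Z w \<Longrightarrow> t i \<in> lists B"
      "\<And>i. i \<in> inits Z w \<Longrightarrow> \<exists>v. w = i @ enc (t i) @ v \<and> (\<nexists>p. prefix p v \<and> p \<in> Z)"
  shows "card (inits (enc ` Y) w) = (\<Sum>i\<in>inits Z w. card (inits Y (t i)))"
proof -
  have iD: "\<nexists>s. suffix s i \<and> s \<in> Z" if "i \<in> inits Z w" for i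
    using that unfolding init_cuts_def by blast
  have sD: "s \<in> lists B" "\<exists>r\<in>lists B. t i = s @ r" "\<nexists>y. suffix y s \<and> y \<in> Y"
    if "i \<in> inits Z w" "s \<in> inits Y (t i)" for i s
    using that t(1)[OF that(1)] unfolding init_cuts_def by auto
  have "bij_betw (\<lambda>(i, s). i @ enc s) (Sigma (inits Z w) (\<lambda>i. inits Y (t i))) (inits (enc ` Y) w)"
  proof (rule bij_betw_imageI)
    show "inj_on (\<lambda>(i, s). i @ enc s) (Sigma (inits Z w) (\<lambda>i. inits Y (t i)))"
    proof (rule inj_onI, clarify)
      fix i s i' s'
      assume i: "i \<in> inits Z w" "s \<in> inits Y (t i)" and i': "i' \<in> inits Z w" "s' \<in> inits Y (t i')"
        and "i @ enc s = i' @ enc s'"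
      then show "i = i' \<and> s = s'"
        using append_enc_eq_append_enc[OF sD(1)[OF i] sD(1)[OF i'] _ iD[OF i(1)] iD[OF i'(1)]] by blast
    qed
    show "(\<lambda>(i, s). i @ enc s) ` Sigma (inits Z w) (\<lambda>i. inits Y (t i)) = inits (enc ` Y) w"
    proof (intro equalityI subsetI)
      fix u assume "u \<in> (\<lambda>(i, s). i @ enc s) ` Sigma (inits Z w) (\<lambda>i. inits Y (t i))"
      then obtain i s where u: "u = i @ enc s" and i: "i \<in> inits Z w" "s \<in> inits Y (t i)" by auto
      obtain r where r: "t i = s @ r" using sD(2)[OF i] by blast
      obtain v where v: "w = i @ enc (t i) @ v" using t(2)[OF i(1)] by blast
      have w: "w = u @ (enc r @ v)" using u r v by simp
      have "\<not> suffix (enc y) u" if y: "y \<in> Y" for y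
      proof
        assume "suffix (enc y) u"
        then obtain q where q: "q @ enc y = i @ enc s" using u unfolding suffix_def by metis
        have yB: "y \<in> lists B" using y Y by blast
        have no: "\<not> suffix y s" using sD(3)[OF i] y by blast
        \<comment> \<open>The word \<open>y\<close> would have to extend \<open>s\<close> to the
          left by codewords taken from the end of \<open>i\<close>, but no codeword ends at the
          first cut \<open>i\<close>.\<close>
        from enc_suffix[OF yB sD(1)[OF i] q] no obtain r'
          where r': "r' \<in> lists B" "y = r' @ s" "i = q @ enc r'" unfolding suffix_def by blast
        show False
        proof (cases r' rule: rev_cases)
          case Nil
          then show False using r' no by simp
        next
          case (snoc r'' b)
          then have "i = (q @ enc r'') @ g b" "g b \<in> Z" using r' g_in by simp_all
          then show False using iD[OF i(1)] unfolding suffix_def by blast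
        qed
      qed
      then show "u \<in> inits (enc ` Y) w" unfolding init_cuts_def using w by blast
    next
      fix u assume "u \<in> inits (enc ` Y) w"
      then obtain v where u: "w = u @ v" "\<And>y. y \<in> Y \<Longrightarrow> \<not> suffix (enc y) u"
        unfolding init_cuts_def by blast
      obtain i s where s: "s \<in> lists B" "u = i @ enc s" "\<nexists>z. suffix z i \<and> z \<in> Z"
        using ex_enc_suffix by blast
      have i: "i \<in> inits Z w" unfolding init_cuts_def using u(1) s by auto
      obtain v' where v': "w = i @ enc (t i) @ v'" "\<nexists>p. prefix p v' \<and> p \<in> Z"
        using t(2)[OF i] by blast
      have "enc s @ v = enc (t i) @ v'" using u(1) s(2) v'(1) by simp
      \<comment> \<open>Decoding from \<open>i\<close> stops after \<open>t i\<close>: if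
        \<open>s\<close> ran past it, the remainder \<open>v'\<close> would begin with a
        codeword.\<close>
      then have "\<exists>r. t i = s @ r"
      proof (rule disjE[OF enc_prefix[OF s(1) t(1)[OF i]]])
        assume "\<exists>r\<in>lists B. s = t i @ r \<and> v' = enc r @ v"
        then obtain r where r: "r \<in> lists B" "s = t i @ r" "v' = enc r @ v" by blast
        have "r = []"
        proof (cases r)
          case (Cons b r')
          then have "prefix (g b) v'" "g b \<in> Z" using r g_in by simp_all
          then show ?thesis using v'(2) by blast
        qed
        then show ?thesis using r by simp
      qed blast
      moreover have "\<not> suffix y s" if "y \<in> Y" for y
        using u(2)[OF that] s(2) unfolding suffix_def by force
      ultimately have "s \<in> inits Y (t i)" unfolding init_cuts_def by blast
      then show "u \<in> (\<lambda>(i, s). i @ enc s) ` Sigma (inits Z w) (\<lambda>i. inits Y (t i))"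
        using i s(2) by (intro image_eqI[of _ _ "(i, s)"]) simp_all
    qed
  qed
  then have "card (inits (enc ` Y) w) = card (Sigma (inits Z w) (\<lambda>i. inits Y (t i)))"
    by (simp add: bij_betw_same_card)
  then show ?thesis by (simp add: finite_init_cuts card_SigmaI)
qed

lemma code_degree_compose:
  assumes ur: "uniformly_recurrent S" and urT: "uniformly_recurrent (decode S)" and fin: "finite Z"
    and Z: "complete_bifix S Z" and Y: "complete_bifix (decode S) Y" "Y \<subseteq> lists B"
    and X: "bifix_code (enc ` Y)"
  shows "code_degree S (enc ` Y) = code_degree (decode S) Y * code_degree S Z"
proof -
  have fac: "factorial_set S" using ur unfolding uniformly_recurrent_def by blast
  have bY: "bifix_code Y" using Y unfolding complete_bifix_def by blast
  obtain dZ N where dZ: "code_degree S Z = enat dZ"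
    "\<And>w. w \<in> S \<Longrightarrow> N \<le> length w \<Longrightarrow> card (parses Z w) = dZ"
    using complete_degree[OF ur Z] by blast
  obtain dY K where dY: "code_degree (decode S) Y = enat dY"
    "\<And>t. t \<in> decode S \<Longrightarrow> K \<le> length t \<Longrightarrow> card (parses Y t) = dY"
    using complete_degree[OF urT Y(1)] by blast
  obtain L where L: "prefix_complete L S Z" "suffix_complete L S Z"
    using Z unfolding complete_bifix_def by blast
  obtain m where m: "\<And>z. z \<in> Z \<Longrightarrow> length z \<le> m" using finite_length_bound[OF fin] by blast
  \<comment> \<open>\<open>N\<close> fixes the number of classes for \<open>Z\<close>; a class
    misses fewer than \<open>L\<close> letters at each end of \<open>w\<close>, so its decoded word
    keeps at least \<open>K\<close> letters and has \<open>dY\<close> parses.\<close>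
  have "card (parses (enc ` Y) w) = dY * dZ" if w: "w \<in> S" "N + 2 * L + m * K \<le> length w" for w
  proof -
    have "\<exists>t. t \<in> lists B \<and> (\<exists>v. w = i @ enc t @ v \<and> (\<nexists>p. prefix p v \<and> p \<in> Z))" if i: "i \<in> inits Z w" for i
    proof -
      obtain u where u: "w = i @ u" using i unfolding init_cuts_def by blast
      obtain t v where "t \<in> lists B" "u = enc t @ v" "\<nexists>p. prefix p v \<and> p \<in> Z"
        using ex_enc_prefix by blast
      then show ?thesis using u by blast
    qed
    then obtain t where t: "\<And>i. i \<in> inits Z w \<Longrightarrow> t i \<in> lists B"
      "\<And>i. i \<in> inits Z w \<Longrightarrow> \<exists>v. w = i @ enc (t i) @ v \<and> (\<nexists>p. prefix p v \<and> p \<in> Z)"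
      by metis
    have "card (inits Y (t i)) = dY" if i: "i \<in> inits Z w" for i
    proof -
      obtain v where v: "w = i @ enc (t i) @ v" "\<nexists>p. prefix p v \<and> p \<in> Z" using t(2)[OF i] by blast
      have in_S: "i \<in> S" "enc (t i) \<in> S" "v \<in> S"
        using w(1) v(1) factorialD[OF fac, of i "enc (t i)" v] factorial_prefixD[OF fac, of i]
          factorial_suffixD[OF fac, of "i @ enc (t i)" v] by simp_all
      have "\<nexists>s. suffix s i \<and> s \<in> Z" using i unfolding init_cuts_def by blast
      then have "length i < L" using suffix_completeD[OF L(2) in_S(1)] by (meson not_less)
      moreover have "length v < L" using prefix_completeD[OF L(1) in_S(3)] v(2) by (meson not_less)
      moreover have "length w = length i + length (enc (t i)) + length v"
        using arg_cong[OF v(1), of length] by simp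
      ultimately have "m * K < length (enc (t i))" using w(2) by simp
      also have "\<dots> \<le> m * length (t i)" using length_enc_le[OF m t(1)[OF i]] .
      finally have "K \<le> length (t i)" by simp
      moreover have "t i \<in> decode S" unfolding decode_def using t(1)[OF i] in_S by simp
      ultimately show ?thesis using dY(2) card_parses_inits[OF bY] by simp
    qed
    then have "card (inits (enc ` Y) w) = card (inits Z w) * dY"
      using card_inits_compose[OF Y(2) t] by simp
    then show ?thesis
      using dZ(2)[OF w(1)] w(2) by (simp add: card_parses_inits[OF X] card_parses_inits[OF bifix])
  qed
  then have "code_degree S (enc ` Y) = enat (dY * dZ)" using code_degree_eqI[OF ur X] by blast
  then show ?thesis by (simp add: dZ dY)
qed

end

theorem theorem6p12:
  fixes A :: "'a set" and B :: "'b set"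
    and S X Z :: "'a list set" and Y T :: "'b list set"
    and f :: "'b list \<Rightarrow> 'a list"
  assumes "finite A" and "A \<noteq> {}" and "finite B"
    and "S \<subseteq> lists A"
    and "uniformly_recurrent S" and "tree_set S"
    and "X \<subseteq> S" and "finite X" and "bifix_code X"
    and "Z \<subseteq> S" and "finite Z" and "bifix_code Z"
    and "decomposes B f X Y Z"
    and "T = {u \<in> lists B. f u \<in> S}"
  shows "(maximal_bifix_code S X \<longleftrightarrow> maximal_bifix_code T Y \<and> maximal_bifix_code S Z) \<and>
    (maximal_bifix_code S X \<longrightarrow> code_degree S X = code_degree T Y * code_degree S Z)"
proof -
  note ur = \<open>uniformly_recurrent S\<close>
  have fac: "factorial_set S" and ext: "right_extendable S"
    using ur unfolding uniformly_recurrent_def by auto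
  have conn: "connected_exts S"
    using \<open>tree_set S\<close> unfolding tree_set_def graph_tree_def connected_exts_def by blast
  have Y: "finite Y" "Y \<subseteq> lists B" and f: "coding_morphism B Z f" and X: "X = f ` Y"
    using \<open>decomposes B f X Y Z\<close> unfolding decomposes_def by auto
  interpret bifix_coding B "\<lambda>b. f [b]" Z
    using f \<open>bifix_code Z\<close> unfolding coding_morphism_def by unfold_locales auto
  have f_enc: "f t = enc t" if "t \<in> lists B" for t
    using that
  proof (induction t)
    case Nil
    then show ?case using f unfolding coding_morphism_def by simp
  next
    case (Cons b t)
    have "f ([b] @ t) = f [b] @ f t"
      using f Cons.hyps unfolding coding_morphism_def by (metis lists.Cons lists.Nil)
    then show ?case using Cons.IH by simp
  qed
  have X_enc: "X = enc ` Y" unfolding X using f_enc Y(2) by (intro image_cong) auto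
  have "f t \<in> S \<longleftrightarrow> enc t \<in> S" if "t \<in> lists B" for t
    using f_enc[OF that] by simp
  then have T: "T = decode S"
    unfolding \<open>T = _\<close> decode_def by blast
  have bX: "bifix_code (enc ` Y)" and XS: "enc ` Y \<subseteq> S"
    using \<open>bifix_code X\<close> \<open>X \<subseteq> S\<close> X_enc by simp_all
  have YT: "Y \<subseteq> T" unfolding T decode_def using Y(2) XS by blast
  \<comment> \<open>Derived from completeness of \<open>Z\<close>, which each direction of the
    equivalence establishes first.\<close>
  have urT: "uniformly_recurrent T" if "complete_bifix S Z"
    using that uniformly_recurrent_decode[OF \<open>finite Z\<close> ur conn] unfolding T complete_bifix_def by blast
  have down: "complete_bifix T Y" "complete_bifix S Z" if "maximal_bifix_code S X"
    using maximal_imp_complete[OF ur \<open>finite X\<close> that] complete_outer[OF Y(2)] complete_inner[OF Y(2)]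
    unfolding X_enc T by blast+
  have "maximal_bifix_code T Y \<and> maximal_bifix_code S Z" if "maximal_bifix_code S X"
  proof
    have "right_extendable T" using urT[OF down(2)[OF that]] unfolding uniformly_recurrent_def by blast
    then show "maximal_bifix_code T Y" using complete_imp_maximal[OF _ down(1)[OF that] YT] by blast
    show "maximal_bifix_code S Z" using complete_imp_maximal[OF ext down(2)[OF that] \<open>Z \<subseteq> S\<close>] .
  qed
  moreover have "maximal_bifix_code S X" if max: "maximal_bifix_code T Y" "maximal_bifix_code S Z"
  proof -
    \<comment> \<open>The order matters: completeness of \<open>Z\<close> makes \<open>T\<close>
      uniformly recurrent, and this is what turns maximality of \<open>Y\<close> into
      completeness.\<close>
    have Z: "complete_bifix S Z" using maximal_imp_complete[OF ur \<open>finite Z\<close> max(2)] .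
    have "complete_bifix (decode S) Y"
      using maximal_imp_complete[OF urT[OF Z] Y(1) max(1)] unfolding T .
    then show ?thesis
      using maximal_compose[OF fac ext \<open>finite Z\<close> Z _ Y(2) bX XS] unfolding X_enc by blast
  qed
  moreover have "code_degree S X = code_degree T Y * code_degree S Z" if "maximal_bifix_code S X"
    using code_degree_compose[OF ur _ \<open>finite Z\<close> down(2)[OF that] _ Y(2) bX] urT down that
    unfolding X_enc T by blast
  ultimately show ?thesis by blast
qed

end
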